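(* Let $F$ be a field of characteristic zero, $m$ a positive integer and $G$ an abelian group. For an arbitrary $G$-grading on $UT_m(F)$ and an arbitrary graded involution $\ast$ on this graded algebra, we have $\mathrm{exp}^{G,\ast}(UT_m(F))=m$.
   Context: $UT_m(F)$ is the algebra of $m\times m$ upper triangular matrices over $F$. A $G$-grading on an algebra $A$ is a vector space decomposition $A=\oplus_{g\in G}A_g$ with $A_gA_h\subseteq A_{gh}$. An involution is a linear map $\ast$ with $(a^\ast)^\ast=a$, $(ab)^\ast=b^\ast a^\ast$; it is graded if $A_g^\ast\subseteq A_g$ for all $g$. $F_{G,\ast}\langle X\rangle$ is the free associative algebra on indeterminates $x_{i,g},x_{i,g}^\ast$ ($i\in\mathbb{N},g\in G$); a polynomial is a $(G,\ast)$-identity for $A$ if it vanishes whenever each $x_{i,g}$ is replaced by an element $a_{i,g}\in A_g$ and $x_{i,g}^\ast$ by $a_{i,g}^\ast$; $T_{G,\ast}(A)$ is the set of these. $P_n^{G,\ast}$ is the span of the monomials $x_{\sigma(1),g_1}^{\delta_1}\cdots x_{\sigma(n),g_n}^{\delta_n}$, $\sigma\in S_n$, $g_i\in G$, $\delta_i\in\{\emptyset,\ast\}$ (here $x^{\emptyset}=x$). Then $c_n^{G,\ast}(A)=\dim P_n^{G,\ast}/(P_n^{G,\ast}\cap T_{G,\ast}(A))$ and $\mathrm{exp}^{G,\ast}(A)=\lim_{n\to\infty}\sqrt[n]{c_n^{G,\ast}(A)}$ when the limit exists (the claim includes the existence of the limit). *)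

theory Defs
  imports
    Complex_Main
    "HOL-Library.FuncSet"
    "HOL-Library.Poly_Mapping"
    "HOL-Combinatorics.Permutations"
    "HOL-Algebra.Group"
    "HOL-Algebra.Module"
    "Jordan_Normal_Form.Matrix"
begin

section \<open>Graded algebras with involution\<close>

text \<open>Associative unital algebras over a field \<open>'f\<close> are HOL-Algebra \<open>module\<close> records, which
  carry a multiplication and a scalar multiplication (the locale \<open>algebra\<close> of HOL-Algebra is not
  used, since it requires commutativity).\<close>

definition UT :: "nat \<Rightarrow> ('f::field, 'f mat) module" where
  "UT m = (module_mat TYPE('f) m m)\<lparr>carrier := {A \<in> carrier_mat m m. upper_triangular A}\<rparr>"

definition linear_subspace :: "('f, 'a, 'r) module_scheme \<Rightarrow> 'a set \<Rightarrow> bool" where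
  "linear_subspace A V \<longleftrightarrow>
     V \<subseteq> carrier A \<and> \<zero>\<^bsub>A\<^esub> \<in> V \<and>
     (\<forall>u\<in>V. \<forall>v\<in>V. u \<oplus>\<^bsub>A\<^esub> v \<in> V) \<and>
     (\<forall>c. \<forall>v\<in>V. c \<odot>\<^bsub>A\<^esub> v \<in> V)"

text \<open>The second conjunct says that the subspaces \<open>\<A> g\<close> form an internal direct sum
  decomposition of \<open>A\<close>; the values of \<open>\<A>\<close> outside \<open>carrier G\<close> are irrelevant.\<close>

definition grading ::
  "('g, 'q) monoid_scheme \<Rightarrow> ('f, 'a, 'r) module_scheme \<Rightarrow> ('g \<Rightarrow> 'a set) \<Rightarrow> bool" where
  "grading G A \<A> \<longleftrightarrow>
     (\<forall>g\<in>carrier G. linear_subspace A (\<A> g)) \<and>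
     (\<forall>a\<in>carrier A. \<exists>!d. d \<in> (\<Pi>\<^sub>E g\<in>carrier G. \<A> g) \<and>
        finite {g\<in>carrier G. d g \<noteq> \<zero>\<^bsub>A\<^esub>} \<and>
        a = finsum A d {g\<in>carrier G. d g \<noteq> \<zero>\<^bsub>A\<^esub>}) \<and>
     (\<forall>g\<in>carrier G. \<forall>h\<in>carrier G. \<forall>a\<in>\<A> g. \<forall>b\<in>\<A> h. a \<otimes>\<^bsub>A\<^esub> b \<in> \<A> (g \<otimes>\<^bsub>G\<^esub> h))"

definition involution :: "('f, 'a, 'r) module_scheme \<Rightarrow> ('a \<Rightarrow> 'a) \<Rightarrow> bool" where
  "involution A star \<longleftrightarrow>
     star \<in> carrier A \<rightarrow> carrier A \<and>
     (\<forall>a\<in>carrier A. \<forall>b\<in>carrier A. star (a \<oplus>\<^bsub>A\<^esub> b) = star a \<oplus>\<^bsub>A\<^esub> star b) \<and>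
     (\<forall>c. \<forall>a\<in>carrier A. star (c \<odot>\<^bsub>A\<^esub> a) = c \<odot>\<^bsub>A\<^esub> star a) \<and>
     (\<forall>a\<in>carrier A. star (star a) = a) \<and>
     (\<forall>a\<in>carrier A. \<forall>b\<in>carrier A. star (a \<otimes>\<^bsub>A\<^esub> b) = star b \<otimes>\<^bsub>A\<^esub> star a)"

definition graded_involution ::
  "('g, 'q) monoid_scheme \<Rightarrow> ('f, 'a, 'r) module_scheme \<Rightarrow> ('g \<Rightarrow> 'a set) \<Rightarrow> ('a \<Rightarrow> 'a) \<Rightarrow> bool" where
  "graded_involution G A \<A> star \<longleftrightarrow>
     involution A star \<and> (\<forall>g\<in>carrier G. star ` \<A> g \<subseteq> \<A> g)"

section \<open>The free algebra and graded star-identities\<close>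

text \<open>\<open>Var i g False\<close> is the indeterminate \<open>x\<close> with indices \<open>i, g\<close>, and \<open>Var i g True\<close> is its star.
  The free algebra is represented by its underlying vector space: words in the indeterminates form
  a basis. Its multiplication is not needed below.\<close>

datatype 'g indet = Var nat 'g bool

type_synonym ('g, 'f) star_poly = "'g indet list \<Rightarrow>\<^sub>0 'f"

definition indets :: "('g, 'q) monoid_scheme \<Rightarrow> 'g indet set" where
  "indets G = {Var i g \<delta> |i g \<delta>. g \<in> carrier G}"

definition free_star_algebra :: "('g, 'q) monoid_scheme \<Rightarrow> ('g, 'f::field) star_poly set" where
  "free_star_algebra G = {f. Poly_Mapping.keys f \<subseteq> lists (indets G)}"

definition poly_scale :: "'f::field \<Rightarrow> ('g, 'f) star_poly \<Rightarrow> ('g, 'f) star_poly" where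
  "poly_scale c f = Poly_Mapping.map (\<lambda>x. c * x) f"

lemma lookup_poly_scale [simp]:
  "Poly_Mapping.lookup (poly_scale c f) w = c * Poly_Mapping.lookup f w"
  by (simp add: poly_scale_def Poly_Mapping.map.rep_eq when_def)

lemma vector_space_poly_scale: "vector_space (poly_scale :: 'f::field \<Rightarrow> ('g, 'f) star_poly \<Rightarrow> _)"
  by unfold_locales (auto intro!: poly_mapping_eqI simp: lookup_add algebra_simps)

fun indet_value :: "('a \<Rightarrow> 'a) \<Rightarrow> (nat \<Rightarrow> 'g \<Rightarrow> 'a) \<Rightarrow> 'g indet \<Rightarrow> 'a" where
  "indet_value star \<phi> (Var i g \<delta>) = (if \<delta> then star (\<phi> i g) else \<phi> i g)"

definition word_value ::
  "('f, 'a, 'r) module_scheme \<Rightarrow> ('a \<Rightarrow> 'a) \<Rightarrow> (nat \<Rightarrow> 'g \<Rightarrow> 'a) \<Rightarrow> 'g indet list \<Rightarrow> 'a" where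
  "word_value A star \<phi> w = foldr (\<lambda>x a. indet_value star \<phi> x \<otimes>\<^bsub>A\<^esub> a) w \<one>\<^bsub>A\<^esub>"

definition poly_value ::
  "('f::field, 'a, 'r) module_scheme \<Rightarrow> ('a \<Rightarrow> 'a) \<Rightarrow> (nat \<Rightarrow> 'g \<Rightarrow> 'a) \<Rightarrow> ('g, 'f) star_poly \<Rightarrow> 'a"
  where
  "poly_value A star \<phi> f =
     finsum A (\<lambda>w. Poly_Mapping.lookup f w \<odot>\<^bsub>A\<^esub> word_value A star \<phi> w) (Poly_Mapping.keys f)"

definition star_identities ::
  "('g, 'q) monoid_scheme \<Rightarrow> ('f::field, 'a, 'r) module_scheme \<Rightarrow> ('g \<Rightarrow> 'a set) \<Rightarrow> ('a \<Rightarrow> 'a) \<Rightarrow>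
     ('g, 'f) star_poly set" where
  "star_identities G A \<A> star =
     {f \<in> free_star_algebra G.
        \<forall>\<phi>. (\<forall>i. \<forall>g\<in>carrier G. \<phi> i g \<in> \<A> g) \<longrightarrow> poly_value A star \<phi> f = \<zero>\<^bsub>A\<^esub>}"

section \<open>Codimensions and the exponent\<close>

definition multilinear_words :: "('g, 'q) monoid_scheme \<Rightarrow> nat \<Rightarrow> 'g indet list set" where
  "multilinear_words G n =
     {map (\<lambda>k. Var (\<sigma> k) (g k) (\<delta> k)) [1..<Suc n] |\<sigma> g \<delta>.
        \<sigma> permutes {1..n} \<and> g \<in> {1..n} \<rightarrow> carrier G}"

definition multilinear_polys :: "('g, 'q) monoid_scheme \<Rightarrow> nat \<Rightarrow> ('g, 'f::field) star_poly set" where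
  "multilinear_polys G n =
     module.span poly_scale ((\<lambda>w. Poly_Mapping.single w 1) ` multilinear_words G n)"

text \<open>\<open>B\<close> is a set of representatives, one for each element, of a basis of the quotient space
  \<open>V / W\<close>. As for the library's dimension, infinite-dimensional quotients get dimension 0; the
  quotients below are finite-dimensional whenever the algebra \<open>A\<close> is, even for infinite \<open>G\<close>, because
  then only finitely many components of the grading are nonzero.\<close>

definition quotient_basis ::
  "('f::field \<Rightarrow> 'v::ab_group_add \<Rightarrow> 'v) \<Rightarrow> 'v set \<Rightarrow> 'v set \<Rightarrow> 'v set \<Rightarrow> bool" where
  "quotient_basis scale V W B \<longleftrightarrow>
     B \<subseteq> V \<and>
     (\<forall>S u. finite S \<and> S \<subseteq> B \<and> (\<Sum>v\<in>S. scale (u v) v) \<in> W \<longrightarrow> (\<forall>v\<in>S. u v = 0)) \<and>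
     (\<forall>v\<in>V. \<exists>b\<in>module.span scale B. v - b \<in> W)"

definition quotient_dim ::
  "('f::field \<Rightarrow> 'v::ab_group_add \<Rightarrow> 'v) \<Rightarrow> 'v set \<Rightarrow> 'v set \<Rightarrow> nat" where
  "quotient_dim scale V W = card (SOME B. quotient_basis scale V W B)"

definition star_codimension ::
  "('g, 'q) monoid_scheme \<Rightarrow> ('f::field, 'a, 'r) module_scheme \<Rightarrow> ('g \<Rightarrow> 'a set) \<Rightarrow> ('a \<Rightarrow> 'a) \<Rightarrow>
     nat \<Rightarrow> nat" where
  "star_codimension G A \<A> star n =
     quotient_dim poly_scale (multilinear_polys G n)
       (multilinear_polys G n \<inter> star_identities G A \<A> star)"

definition star_exponent_exists ::
  "('g, 'q) monoid_scheme \<Rightarrow> ('f::field, 'a, 'r) module_scheme \<Rightarrow> ('g \<Rightarrow> 'a set) \<Rightarrow> ('a \<Rightarrow> 'a) \<Rightarrow>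
     bool" where
  "star_exponent_exists G A \<A> star \<longleftrightarrow>
     convergent (\<lambda>n. root n (real (star_codimension G A \<A> star n)))"

definition star_exponent ::
  "('g, 'q) monoid_scheme \<Rightarrow> ('f::field, 'a, 'r) module_scheme \<Rightarrow> ('g \<Rightarrow> 'a set) \<Rightarrow> ('a \<Rightarrow> 'a) \<Rightarrow>
     real" where
  "star_exponent G A \<A> star = lim (\<lambda>n. root n (real (star_codimension G A \<A> star n)))"

end

theory Submission
  imports Defs
begin

text \<open>Upper bound: every admissible evaluation of a multilinear polynomial is a combination of its
  values at tuples of matrix units, a unit \<open>e\<close> being encoded by the family of its homogeneous
  components. Since \<open>G\<close> is abelian, the components of \<open>e\<^sub>j\<^sub>k\<close> with \<open>j < k\<close> lie in the radical, and so do
  their images under the involution; hence tuples with at least \<open>m\<close> off-diagonal entries contribute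
  nothing, and only polynomially many times \<open>m ^ n\<close> tuples remain. Lower bound: the \<open>m ^ N\<close> words
  \<open>X\<^sub>0 y\<^sub>1 X\<^sub>1 y\<^sub>2 \<dots> y\<^sub>m\<^sub>-\<^sub>1 X\<^sub>m\<^sub>-\<^sub>1\<close>, where the \<open>X\<^sub>j\<close> distribute \<open>N\<close> variables into \<open>m\<close> blocks, are
  separated by the substitutions that send \<open>y\<^sub>j\<close> to \<open>e\<^sub>j\<^sub>-\<^sub>1\<^sub>,\<^sub>j\<close> and every other variable to a diagonal unit.\<close>

section \<open>Dimension bounds for quotients by functionals\<close>

text \<open>The grading and the involution are arbitrary, so matrix units need be neither
  homogeneous nor mapped to matrix units, and a unit cannot simply be substituted for a graded
  variable. This is why it enters as a family: the indeterminate with indices \<open>i, g\<close>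
  takes the \<open>g\<close>-component of the \<open>i\<close>-th unit, for all \<open>g\<close>
  simultaneously. A multilinear word contains each index once and sees one member of each family,
  while different words of one polynomial may see different members. In the lower bound the units
  have to reappear whole, so each word there stands for the sum of its versions over all assignments
  of degrees from a finite set; summing over degrees glues the components together again. Both
  bounds are then duality statements: modulo identities, multilinear polynomials are separated by
  finitely many functionals, namely the matrix entries of the values at unit tuples. With c_n the
  codimension this gives m^(n-m+1) <= c_n for n >= m - 1 and c_n <= m^2 n^m (m + m^2/n)^n for n >=
  1, and the n-th roots of both sides tend to m.\<close>

lemma homogeneous_system_nontrivial:
  fixes a :: "'k \<Rightarrow> 's \<Rightarrow> 'f::field"
  assumes "finite K" "finite S" "card K < card S"
  shows "\<exists>u. (\<exists>s\<in>S. u s \<noteq> 0) \<and> (\<forall>k\<in>K. (\<Sum>s\<in>S. u s * a k s) = 0)"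
  using assms
proof (induction K arbitrary: S a rule: finite_induct)
  case empty
  then have "S \<noteq> {}" by auto
  then show ?case by (intro exI[of _ "\<lambda>_. 1"]) auto
next
  case (insert k K)
  show ?case
  proof (cases "\<forall>s\<in>S. a k s = 0")
    case True
    moreover obtain u where "\<exists>s\<in>S. u s \<noteq> 0" "\<forall>k\<in>K. (\<Sum>s\<in>S. u s * a k s) = 0"
      using insert.IH[of S a] insert.prems insert.hyps by auto
    ultimately show ?thesis by (intro exI[of _ u]) auto
  next
    case False
    then obtain s0 where s0: "s0 \<in> S" "a k s0 \<noteq> 0" by blast
    let ?S = "S - {s0}"
    \<comment> \<open>Gaussian elimination: equation \<open>k\<close> is solved for the unknown
      \<open>s0\<close>, and \<open>?a\<close> holds the coefficients of the other equations after
      substituting that solution.\<close>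
    let ?a = "\<lambda>j s. a j s - a j s0 * a k s / a k s0"
    have "card K < card ?S" using insert.prems insert.hyps s0 by auto
    then obtain u where u: "\<exists>s\<in>?S. u s \<noteq> 0" "\<forall>j\<in>K. (\<Sum>s\<in>?S. u s * ?a j s) = 0"
      using insert.IH[of ?S ?a] insert.prems by auto
    define v where "v = u(s0 := - (\<Sum>s\<in>?S. u s * a k s / a k s0))"
    have split: "(\<Sum>s\<in>S. v s * a j s) = v s0 * a j s0 + (\<Sum>s\<in>?S. u s * a j s)" for j
      using insert.prems s0 by (simp add: sum.remove[of S s0] v_def)
    have "(\<Sum>s\<in>S. v s * a j s) = (\<Sum>s\<in>?S. u s * ?a j s)" for j
      unfolding split
      by (simp add: v_def sum_distrib_right sum_distrib_left right_diff_distrib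
          sum_subtractf mult_ac flip: sum_negf)
    moreover have "(\<Sum>s\<in>?S. u s * ?a k s) = 0" using s0 by (simp add: field_simps)
    ultimately have "\<forall>j\<in>insert k K. (\<Sum>s\<in>S. v s * a j s) = 0" using u(2) by auto
    moreover have "\<exists>s\<in>S. v s \<noteq> 0" using u(1) by (auto simp: v_def)
    ultimately show ?thesis by blast
  qed
qed

context vector_space
begin

context
  fixes V W :: "'b set" and \<L> :: "('b \<Rightarrow> 'a) set"
  assumes V: "subspace V" and W: "subspace W"
    and linear_\<L>: "\<And>L. L \<in> \<L> \<Longrightarrow> Vector_Spaces.linear scale (*) L"
    and vanish: "\<And>L w. L \<in> \<L> \<Longrightarrow> w \<in> W \<Longrightarrow> L w = 0"
begin

lemma functional_sum:
  assumes "L \<in> \<L>"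
  shows "L (\<Sum>v\<in>S. scale (u v) v) = (\<Sum>v\<in>S. u v * L v)"
proof -
  interpret L: Vector_Spaces.linear scale "(*)" L by (rule linear_\<L>[OF assms])
  show ?thesis by (simp add: L.sum L.scale)
qed

text \<open>The functionals kill \<open>W\<close>, so on \<open>V\<close> they are determined by
  their values on \<open>B\<close>. If \<open>B\<close> had fewer elements than \<open>I\<close>, a
  nontrivial combination of the \<open>l i\<close> would vanish on \<open>B\<close>, hence on
  \<open>V\<close>; but its value at \<open>p j\<close> is the coefficient
  \<open>u j\<close>.\<close>

lemma quotient_basis_card_ge:
  assumes B: "quotient_basis scale V W B" "finite B" and I: "finite I"
    and p: "\<And>i. i \<in> I \<Longrightarrow> p i \<in> V" and l: "\<And>i. i \<in> I \<Longrightarrow> l i \<in> \<L>"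
    and dual: "\<And>i j. i \<in> I \<Longrightarrow> j \<in> I \<Longrightarrow> l i (p j) = (if i = j then 1 else 0)"
  shows "card I \<le> card B"
proof (rule ccontr)
  assume "\<not> ?thesis"
  then have "card B < card I" by simp
  then obtain u where u: "\<exists>i\<in>I. u i \<noteq> 0" "\<forall>b\<in>B. (\<Sum>i\<in>I. u i * l i b) = 0"
    using homogeneous_system_nontrivial[OF B(2) I, of "\<lambda>b i. l i b"] by auto
  have "u j = 0" if j: "j \<in> I" for j
  proof -
    obtain b where b: "b \<in> span B" "p j - b \<in> W"
      using B(1) p[OF j] unfolding quotient_basis_def by blast
    then obtain c where c: "b = (\<Sum>v\<in>B. scale (c v) v)"
      using span_finite[OF B(2)] by auto
    have eq: "l i (p j) = l i b" if i: "i \<in> I" for i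
    proof -
      interpret L: Vector_Spaces.linear scale "(*)" "l i" by (rule linear_\<L>[OF l[OF i]])
      show ?thesis using vanish[OF l[OF i] b(2)] by (simp add: L.diff)
    qed
    have "u j = (\<Sum>i\<in>I. u i * l i (p j))"
      using I j by (simp add: dual sum.delta' if_distrib cong: if_cong)
    also have "\<dots> = (\<Sum>i\<in>I. u i * (\<Sum>v\<in>B. c v * l i v))"
      by (intro sum.cong refl) (simp add: eq c functional_sum l)
    also have "\<dots> = (\<Sum>v\<in>B. c v * (\<Sum>i\<in>I. u i * l i v))"
      by (simp add: sum_distrib_left mult_ac) (rule sum.swap)
    also have "\<dots> = 0" using u(2) by simp
    finally show ?thesis .
  qed
  then show False using u(1) by blast
qed

context
  assumes finite_\<L>: "finite \<L>"
    and separate: "\<And>v. v \<in> V \<Longrightarrow> (\<And>L. L \<in> \<L> \<Longrightarrow> L v = 0) \<Longrightarrow> v \<in> W"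
begin

text \<open>More vectors than functionals admit a nontrivial combination killed by every functional,
  and separation puts this combination into \<open>W\<close>.\<close>

lemma independent_mod_card_le:
  assumes S: "finite S" "S \<subseteq> V"
    and ind: "\<And>u. (\<Sum>v\<in>S. scale (u v) v) \<in> W \<Longrightarrow> \<forall>v\<in>S. u v = 0"
  shows "card S \<le> card \<L>"
proof (rule ccontr)
  assume "\<not> ?thesis"
  then have "card \<L> < card S" by simp
  then obtain u where u: "\<exists>v\<in>S. u v \<noteq> 0" "\<forall>L\<in>\<L>. (\<Sum>v\<in>S. u v * L v) = 0"
    using homogeneous_system_nontrivial[OF finite_\<L> S(1), of "\<lambda>L. L"] by auto
  have "(\<Sum>v\<in>S. scale (u v) v) \<in> V"
    using S(2) by (intro subspace_sum[OF V] subspace_scale[OF V]) auto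
  then have "(\<Sum>v\<in>S. scale (u v) v) \<in> W"
    by (rule separate) (use u(2) in \<open>simp add: functional_sum\<close>)
  then show False using ind u(1) by blast
qed

lemma quotient_basis_card_le:
  assumes "quotient_basis scale V W B"
  shows "finite B" "card B \<le> card \<L>"
proof -
  have *: "card S \<le> card \<L>" if "finite S" "S \<subseteq> B" for S
    using assms that unfolding quotient_basis_def by (intro independent_mod_card_le) blast+
  show "finite B"
  proof (rule ccontr)
    assume "infinite B"
    then obtain S where "S \<subseteq> B" "finite S" "card S = Suc (card \<L>)"
      using infinite_arbitrarily_large by blast
    then show False using * by fastforce
  qed
  then show "card B \<le> card \<L>" using * by blast
qed

text \<open>The sizes of families independent modulo \<open>W\<close> are bounded by
  \<open>card \<L>\<close>, so a largest one exists. Adding a vector outside its span breaks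
  independence, and the resulting relation expresses that vector modulo \<open>W\<close>.\<close>

lemma quotient_basis_exists: "\<exists>B. quotient_basis scale V W B"
proof -
  define ind where "ind S \<longleftrightarrow> finite S \<and> S \<subseteq> V \<and>
    (\<forall>u. (\<Sum>v\<in>S. scale (u v) v) \<in> W \<longrightarrow> (\<forall>v\<in>S. u v = 0))" for S
  have "ind {}" by (simp add: ind_def)
  moreover have "\<forall>S. ind S \<longrightarrow> card S < Suc (card \<L>)"
    using independent_mod_card_le by (auto simp: ind_def less_Suc_eq_le)
  ultimately obtain B where B: "ind B" and max: "\<And>S. ind S \<Longrightarrow> card S \<le> card B"
    using ex_has_greatest_nat[of ind "{}" card] by blast
  have fin: "finite B" and sub: "B \<subseteq> V"
    and indB: "\<And>u. (\<Sum>v\<in>B. scale (u v) v) \<in> W \<Longrightarrow> \<forall>v\<in>B. u v = 0"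
    using B by (auto simp: ind_def)
  have "\<forall>v\<in>S. u v = 0" if S: "S \<subseteq> B" "(\<Sum>v\<in>S. scale (u v) v) \<in> W" for S u
  proof -
    \<comment> \<open>\<open>quotient_basis\<close> asks for independence of every finite subset,
      \<open>ind\<close> only of the whole set; coefficients on \<open>S\<close> are extended by
      zero.\<close>
    have "(\<Sum>v\<in>B. scale (if v \<in> S then u v else 0) v) = (\<Sum>v\<in>S. scale (u v) v)"
      using S(1) fin by (intro sum.mono_neutral_cong_right) auto
    with S(2) have "(\<Sum>v\<in>B. scale (if v \<in> S then u v else 0) v) \<in> W" by (simp only:)
    then have "\<forall>v\<in>B. (if v \<in> S then u v else 0) = 0" by (rule indB)
    then show ?thesis using S(1) by (metis subsetD)
  qed
  moreover have "\<exists>b\<in>span B. v - b \<in> W" if v: "v \<in> V" for v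
  proof (cases "v \<in> span B")
    case True
    then show ?thesis using subspace_0[OF W] by (intro bexI[of _ v]) auto
  next
    case False
    then have vB: "v \<notin> B" using span_base by blast
    then have "\<not> ind (insert v B)" using max[of "insert v B"] fin by auto
    then obtain u where u: "(\<Sum>x\<in>insert v B. scale (u x) x) \<in> W" "\<exists>x\<in>insert v B. u x \<noteq> 0"
      using fin sub v by (auto simp: ind_def)
    have sum: "scale (u v) v + (\<Sum>x\<in>B. scale (u x) x) \<in> W" using u(1) fin vB by simp
    have uv: "u v \<noteq> 0" using sum indB[of u] u(2) by auto
    let ?b = "scale (- inverse (u v)) (\<Sum>x\<in>B. scale (u x) x)"
    have "v - ?b = scale (inverse (u v)) (scale (u v) v + (\<Sum>x\<in>B. scale (u x) x))"
      using uv by (simp add: scale_right_distrib)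
    then have "v - ?b \<in> W" using subspace_scale[OF W sum] by simp
    moreover have "?b \<in> span B" by (intro span_scale span_sum) (auto intro: span_base)
    ultimately show ?thesis by blast
  qed
  ultimately show ?thesis using sub by (auto simp: quotient_basis_def)
qed

text \<open>\<open>quotient_dim\<close> measures a basis picked by \<open>SOME\<close>, so it
  becomes meaningful only once a basis is known to exist; the two cardinality bounds then apply to
  the chosen one.\<close>

lemma quotient_dim_bounds:
  shows "quotient_dim scale V W \<le> card \<L>"
    and "\<lbrakk>finite I; \<And>i. i \<in> I \<Longrightarrow> p i \<in> V; \<And>i. i \<in> I \<Longrightarrow> l i \<in> \<L>;
          \<And>i j. i \<in> I \<Longrightarrow> j \<in> I \<Longrightarrow> l i (p j) = (if i = j then 1 else 0)\<rbrakk>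
         \<Longrightarrow> card I \<le> quotient_dim scale V W"
proof -
  have B: "quotient_basis scale V W (SOME B. quotient_basis scale V W B)"
    using quotient_basis_exists by (rule someI_ex)
  show "quotient_dim scale V W \<le> card \<L>"
    unfolding quotient_dim_def by (rule quotient_basis_card_le(2)[OF B])
  show "card I \<le> quotient_dim scale V W"
    if "finite I" "\<And>i. i \<in> I \<Longrightarrow> p i \<in> V" "\<And>i. i \<in> I \<Longrightarrow> l i \<in> \<L>"
      "\<And>i j. i \<in> I \<Longrightarrow> j \<in> I \<Longrightarrow> l i (p j) = (if i = j then 1 else 0)"
    unfolding quotient_dim_def
    by (rule quotient_basis_card_ge[OF B quotient_basis_card_le(1)[OF B]]) (use that in auto)
qed

end
end
end

section \<open>Upper triangular matrices\<close>

lemma carrier_UT: "carrier (UT m) = {A \<in> carrier_mat m m. upper_triangular A}"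
  and mult_UT [simp]: "A \<otimes>\<^bsub>UT m\<^esub> B = A * B"
  and one_UT [simp]: "\<one>\<^bsub>UT m\<^esub> = 1\<^sub>m m"
  and zero_UT [simp]: "\<zero>\<^bsub>UT m\<^esub> = 0\<^sub>m m m"
  and add_UT [simp]: "A \<oplus>\<^bsub>UT m\<^esub> B = A + B"
  and smult_UT [simp]: "c \<odot>\<^bsub>UT m\<^esub> A = c \<cdot>\<^sub>m A"
  by (simp_all add: UT_def module_mat_def)

lemma UT_dim: "A \<in> carrier (UT m) \<Longrightarrow> A \<in> carrier_mat m m"
  by (simp add: carrier_UT)

lemma UT_lower_zero: "\<lbrakk>A \<in> carrier (UT m); c < r; r < m\<rbrakk> \<Longrightarrow> A $$ (r, c) = 0"
  by (auto simp: carrier_UT)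

lemma UT_I: "\<lbrakk>A \<in> carrier_mat m m; \<And>r c. c < r \<Longrightarrow> r < m \<Longrightarrow> A $$ (r, c) = 0\<rbrakk> \<Longrightarrow> A \<in> carrier (UT m)"
  by (auto simp: carrier_UT)

lemma UT_zero: "0\<^sub>m m m \<in> carrier (UT m)" and UT_one: "1\<^sub>m m \<in> carrier (UT m)"
  by (rule UT_I; simp)+

lemma index_mult_sum:
  assumes "A \<in> carrier_mat m m" "B \<in> carrier_mat m m" "r < m" "c < m"
  shows "(A * B) $$ (r, c) = (\<Sum>k<m. A $$ (r, k) * B $$ (k, c))"
  using assms by (auto simp: scalar_prod_def lessThan_atLeast0 intro!: sum.cong)

lemma UT_mult:
  assumes "A \<in> carrier (UT m)" "B \<in> carrier (UT m)"
  shows "A * B \<in> carrier (UT m)"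
proof (rule UT_I)
  show "A * B \<in> carrier_mat m m" using assms by (auto simp: carrier_UT)
next
  fix r c :: nat assume rc: "c < r" "r < m"
  have "A $$ (r, k) * B $$ (k, c) = 0" if "k < m" for k
    using UT_lower_zero[OF assms(1), of k r] UT_lower_zero[OF assms(2), of c k] rc that
    by (cases "k < r") auto
  then show "(A * B) $$ (r, c) = 0"
    using rc assms by (subst index_mult_sum[where m = m]) (auto simp: carrier_UT intro!: sum.neutral)
qed

lemma UT_diag_mult:
  assumes "A \<in> carrier (UT m)" "B \<in> carrier (UT m)" "i < m"
  shows "(A * B) $$ (i, i) = A $$ (i, i) * B $$ (i, i)"
proof -
  have "(A * B) $$ (i, i) = (\<Sum>k<m. A $$ (i, k) * B $$ (k, i))"
    using assms by (intro index_mult_sum) (auto simp: carrier_UT)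
  also have "\<dots> = (\<Sum>k\<in>{i}. A $$ (i, k) * B $$ (k, i))"
  proof (rule sum.mono_neutral_right)
    show "\<forall>k\<in>{..<m} - {i}. A $$ (i, k) * B $$ (k, i) = 0"
    proof
      fix k assume "k \<in> {..<m} - {i}"
      then show "A $$ (i, k) * B $$ (k, i) = 0"
        using UT_lower_zero[OF assms(1), of k i] UT_lower_zero[OF assms(2), of i k] assms(3)
        by (cases "k < i") auto
    qed
  qed (use assms in auto)
  finally show ?thesis by simp
qed

lemma abelian_monoid_UT: "abelian_monoid (UT m :: ('f::field, 'f mat) module)"
proof (rule abelian_monoidI, unfold add_UT zero_UT)
  fix x y z :: "'f mat"
  assume "x \<in> carrier (UT m)" "y \<in> carrier (UT m)" "z \<in> carrier (UT m)"
  then show "x + y + z = x + (y + z)" by (auto simp: carrier_UT intro: assoc_add_mat)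
next
  fix x y :: "'f mat"
  assume xy: "x \<in> carrier (UT m)" "y \<in> carrier (UT m)"
  show "x + y \<in> carrier (UT m)"
    using UT_dim[OF xy(1)] UT_lower_zero[OF xy(1)] UT_dim[OF xy(2)] UT_lower_zero[OF xy(2)]
    by (intro UT_I) auto
qed (auto simp: carrier_UT intro!: comm_add_mat)

text \<open>The entrywise form turns identities between linear combinations of matrices into
  identities of sums in the field, without carrier side conditions on the summands.\<close>

definition lincomb :: "nat \<Rightarrow> 't set \<Rightarrow> ('t \<Rightarrow> 'f) \<Rightarrow> ('t \<Rightarrow> 'f mat) \<Rightarrow> 'f::field mat" where
  "lincomb m T c M = mat m m (\<lambda>rc. \<Sum>t\<in>T. c t * M t $$ rc)"

lemma index_lincomb [simp]:
  "\<lbrakk>r < m; s < m\<rbrakk> \<Longrightarrow> lincomb m T c M $$ (r, s) = (\<Sum>t\<in>T. c t * M t $$ (r, s))"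
  and lincomb_dim [simp]: "lincomb m T c M \<in> carrier_mat m m"
  and lincomb_dim_row [simp]: "dim_row (lincomb m T c M) = m"
  and lincomb_dim_col [simp]: "dim_col (lincomb m T c M) = m"
  by (auto simp: lincomb_def)

lemma lincomb_empty: "lincomb m {} c M = 0\<^sub>m m m"
  by (rule eq_matI) (auto simp: lincomb_def)

lemma lincomb_insert:
  assumes "finite T" "t \<notin> T" "M t \<in> carrier_mat m m"
  shows "lincomb m (insert t T) c M = c t \<cdot>\<^sub>m M t + lincomb m T c M"
  using assms by (intro eq_matI) (auto simp: lincomb_def)

lemma linear_subspace_lincomb:
  assumes V: "linear_subspace (UT m) V" and "finite T" "\<And>t. t \<in> T \<Longrightarrow> M t \<in> V"
  shows "lincomb m T c M \<in> V"
  using assms(2,3)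
proof (induction T rule: finite_induct)
  case empty
  then show ?case using V by (simp add: linear_subspace_def lincomb_empty)
next
  case (insert t T)
  then have "M t \<in> carrier_mat m m" using V by (auto simp: linear_subspace_def carrier_UT)
  then show ?case using insert V by (simp add: lincomb_insert linear_subspace_def)
qed

lemma UT_lincomb:
  assumes "\<And>t. t \<in> T \<Longrightarrow> M t \<in> carrier (UT m)"
  shows "lincomb m T c M \<in> carrier (UT m)"
  by (rule UT_I) (simp_all add: UT_lower_zero[OF assms] sum.neutral)

lemma finsum_UT:
  fixes M :: "'t \<Rightarrow> 'f::field mat"
  assumes "finite T" "\<And>t. t \<in> T \<Longrightarrow> M t \<in> carrier (UT m)"
  shows "finsum (UT m) M T = lincomb m T (\<lambda>_. 1) M"
  using assms
proof (induction T rule: finite_induct)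
  case empty
  then show ?case
    by (simp add: abelian_monoid.finsum_empty[OF abelian_monoid_UT] lincomb_empty)
next
  case (insert t T)
  interpret abelian_monoid "UT m :: ('f, 'f mat) module" by (rule abelian_monoid_UT)
  have "M t \<in> carrier_mat m m" using insert.prems by (auto dest: UT_dim)
  then show ?case using insert by (subst finsum_insert) (auto simp: lincomb_insert)
qed

text \<open>Positions below the diagonal yield the zero matrix, so that the result is upper
  triangular for every \<open>t\<close>.\<close>

definition unit_mat :: "nat \<Rightarrow> nat \<times> nat \<Rightarrow> 'f::field mat" where
  "unit_mat m t = mat m m (\<lambda>rc. if rc = t \<and> fst t \<le> snd t then 1 else 0)"

definition unit_indices :: "nat \<Rightarrow> (nat \<times> nat) set" where
  "unit_indices m = {(j, k). j \<le> k \<and> k < m}"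

lemma finite_unit_indices [simp]: "finite (unit_indices m)"
  by (rule finite_subset[of _ "{..<m} \<times> {..<m}"]) (auto simp: unit_indices_def)

lemma index_unit_mat [simp]:
  "\<lbrakk>r < m; s < m\<rbrakk> \<Longrightarrow> unit_mat m t $$ (r, s) = (if (r, s) = t \<and> fst t \<le> snd t then 1 else 0)"
  by (simp add: unit_mat_def)

lemma UT_unit_mat: "unit_mat m t \<in> carrier (UT m)"
  by (rule UT_I) (auto simp: unit_mat_def)

lemma UT_unit_expansion:
  assumes "A \<in> carrier (UT m)"
  shows "A = lincomb m (unit_indices m) (\<lambda>t. A $$ t) (unit_mat m)"
proof (rule eq_matI)
  fix r s assume "r < dim_row (lincomb m (unit_indices m) (\<lambda>t. A $$ t) (unit_mat m))"
    "s < dim_col (lincomb m (unit_indices m) (\<lambda>t. A $$ t) (unit_mat m))"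
  then have rs: "r < m" "s < m" by auto
  have "(\<Sum>t\<in>unit_indices m. A $$ t * unit_mat m t $$ (r, s))
      = (\<Sum>t\<in>unit_indices m. if t = (r, s) then A $$ (r, s) else 0)"
    using rs by (intro sum.cong) (auto simp: unit_indices_def)
  also have "\<dots> = A $$ (r, s)"
    using rs UT_lower_zero[OF assms, of s r]
    by (subst sum.delta[OF finite_unit_indices]) (auto simp: unit_indices_def not_le)
  finally show "A $$ (r, s) = lincomb m (unit_indices m) (\<lambda>t. A $$ t) (unit_mat m) $$ (r, s)"
    using rs by simp
qed (use assms in \<open>auto simp: carrier_UT\<close>)

lemma unit_mat_mult:
  assumes "j < k" "k < m"
  shows "unit_mat m (j, j) * unit_mat m (j, k) = (unit_mat m (j, k) :: 'f::field mat)"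
    and "unit_mat m (j, k) * unit_mat m (j, j) = (0\<^sub>m m m :: 'f::field mat)"
proof -
  have d: "unit_mat m t \<in> carrier_mat m m" for t by (simp add: unit_mat_def)
  show "unit_mat m (j, j) * unit_mat m (j, k) = (unit_mat m (j, k) :: 'f mat)"
  proof (rule eq_matI)
    fix r c assume "r < dim_row (unit_mat m (j, k) :: 'f mat)" "c < dim_col (unit_mat m (j, k) :: 'f mat)"
    then have rc: "r < m" "c < m" by (auto simp: unit_mat_def)
    have "(unit_mat m (j, j) * unit_mat m (j, k)) $$ (r, c)
      = (\<Sum>l<m. unit_mat m (j, j) $$ (r, l) * (unit_mat m (j, k) :: 'f mat) $$ (l, c))"
      by (rule index_mult_sum[OF d d rc])
    also have "\<dots> = (\<Sum>l<m. if l = j then (if (r, c) = (j, k) then 1 else 0) else 0)"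
      using rc assms by (intro sum.cong) auto
    also have "\<dots> = (unit_mat m (j, k) :: 'f mat) $$ (r, c)"
      using rc assms by (subst sum.delta) auto
    finally show "(unit_mat m (j, j) * unit_mat m (j, k)) $$ (r, c) = (unit_mat m (j, k) :: 'f mat) $$ (r, c)" .
  qed (simp_all add: unit_mat_def)
  show "unit_mat m (j, k) * unit_mat m (j, j) = (0\<^sub>m m m :: 'f mat)"
  proof (rule eq_matI)
    fix r c assume "r < dim_row (0\<^sub>m m m :: 'f mat)" "c < dim_col (0\<^sub>m m m :: 'f mat)"
    then have rc: "r < m" "c < m" by auto
    then show "(unit_mat m (j, k) * unit_mat m (j, j)) $$ (r, c) = (0\<^sub>m m m :: 'f mat) $$ (r, c)"
      using assms by (subst index_mult_sum[OF d d]) (auto intro!: sum.neutral)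
  qed (simp_all add: unit_mat_def)
qed

text \<open>Membership in the \<open>d\<close>-th power of the radical of \<open>UT m\<close>.\<close>

definition radical_level :: "nat \<Rightarrow> nat \<Rightarrow> 'f::field mat \<Rightarrow> bool" where
  "radical_level m d A \<longleftrightarrow> A \<in> carrier_mat m m \<and> (\<forall>r<m. \<forall>c<m. c < r + d \<longrightarrow> A $$ (r, c) = 0)"

lemma radical_level_0: "A \<in> carrier (UT m) \<Longrightarrow> radical_level m 0 A"
  by (auto simp: radical_level_def carrier_UT)

lemma radical_level_1:
  assumes "A \<in> carrier (UT m)" "\<And>i. i < m \<Longrightarrow> A $$ (i, i) = 0"
  shows "radical_level m 1 A"
  using assms UT_lower_zero[OF assms(1)]
  by (auto simp: radical_level_def carrier_UT less_Suc_eq)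

text \<open>A summand of entry \<open>(r, c)\<close> passing through \<open>k\<close> survives only
  if \<open>r + d \<le> k\<close> and \<open>k + e \<le> c\<close>.\<close>

lemma radical_level_mult:
  assumes "radical_level m d A" "radical_level m e B"
  shows "radical_level m (d + e) (A * B)"
  unfolding radical_level_def
proof (intro conjI allI impI)
  show "A * B \<in> carrier_mat m m" using assms by (auto simp: radical_level_def)
  fix r c assume rc: "r < m" "c < m" "c < r + (d + e)"
  have "A $$ (r, k) * B $$ (k, c) = 0" if "k < m" for k
    using assms rc that by (cases "k < r + d") (simp_all add: radical_level_def)
  then have "(\<Sum>k<m. A $$ (r, k) * B $$ (k, c)) = 0" by (intro sum.neutral) blast
  then show "(A * B) $$ (r, c) = 0"
    using index_mult_sum[of A m B r c] rc assms unfolding radical_level_def by metis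
qed

lemma involution_lincomb:
  assumes inv: "involution (UT m) star" and T: "finite T" "\<And>t. t \<in> T \<Longrightarrow> M t \<in> carrier (UT m)"
  shows "star (lincomb m T c M) = lincomb m T c (\<lambda>t. star (M t))"
proof -
  have add: "star (a + b) = star a + star b"
    if "a \<in> carrier (UT m)" "b \<in> carrier (UT m)" for a b
    using inv that unfolding involution_def by simp
  have smult: "star (c \<cdot>\<^sub>m a) = c \<cdot>\<^sub>m star a" if "a \<in> carrier (UT m)" for c a
    using inv that unfolding involution_def by simp
  have closed: "star a \<in> carrier (UT m)" if "a \<in> carrier (UT m)" for a
    using inv that unfolding involution_def by auto
  have smult_closed: "c \<cdot>\<^sub>m a \<in> carrier (UT m)" if "a \<in> carrier (UT m)" for c and a :: "'a mat"
    using UT_dim[OF that] UT_lower_zero[OF that] by (intro UT_I) auto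
  show ?thesis using T
  proof (induction T rule: finite_induct)
    case empty
    \<comment> \<open>That \<open>star\<close> fixes zero is not part of the definition of an
      involution; it follows from compatibility with the scalar 0.\<close>
    have "star (0 \<cdot>\<^sub>m 0\<^sub>m m m) = 0 \<cdot>\<^sub>m star (0\<^sub>m m m)" by (rule smult[OF UT_zero])
    moreover have "0 \<cdot>\<^sub>m a = 0\<^sub>m m m" if "a \<in> carrier (UT m)" for a :: "'a mat"
      using that by (intro eq_matI) (auto simp: carrier_UT)
    ultimately show ?case using UT_zero closed[OF UT_zero] by (simp add: lincomb_empty)
  next
    case (insert t T)
    then have "M t \<in> carrier (UT m)" by simp
    then have "M t \<in> carrier_mat m m" "star (M t) \<in> carrier_mat m m"
      by (auto intro!: UT_dim closed)
    with insert show ?case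
      by (simp add: lincomb_insert add smult UT_lincomb smult_closed)
  qed
qed

section \<open>Homogeneous components\<close>

locale graded_UT =
  fixes G :: "('g, 'q) monoid_scheme"
    and m :: nat
    and \<A> :: "'g \<Rightarrow> 'f::field_char_0 mat set"
    and star :: "'f mat \<Rightarrow> 'f mat"
  assumes comm_group_G: "comm_group G"
    and m_pos: "m > 0"
    and grading_\<A>: "grading G (UT m) \<A>"
    and star: "graded_involution G (UT m) \<A> star"
begin

abbreviation U :: "'f mat set" where "U \<equiv> carrier (UT m)"

sublocale G: comm_group G by (rule comm_group_G)

lemma subspace_\<A>: "g \<in> carrier G \<Longrightarrow> linear_subspace (UT m) (\<A> g)"
  and \<A>_mult: "\<lbrakk>g \<in> carrier G; h \<in> carrier G; a \<in> \<A> g; b \<in> \<A> h\<rbrakk> \<Longrightarrow> a * b \<in> \<A> (g \<otimes>\<^bsub>G\<^esub> h)"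
  using grading_\<A> by (auto simp: grading_def)

lemma \<A>_U: "\<lbrakk>g \<in> carrier G; a \<in> \<A> g\<rbrakk> \<Longrightarrow> a \<in> U"
  using subspace_\<A>[of g] unfolding linear_subspace_def by blast

lemma \<A>_zero: "g \<in> carrier G \<Longrightarrow> 0\<^sub>m m m \<in> \<A> g"
  using subspace_\<A> by (auto simp: linear_subspace_def)

lemma star_involution: "involution (UT m) star"
  using star by (simp add: graded_involution_def)

lemma star_U: "a \<in> U \<Longrightarrow> star a \<in> U"
  and star_mult: "\<lbrakk>a \<in> U; b \<in> U\<rbrakk> \<Longrightarrow> star (a * b) = star b * star a"
  using star_involution by (auto simp: involution_def)

definition supp :: "('g \<Rightarrow> 'f mat) \<Rightarrow> 'g set" where
  "supp d = {g \<in> carrier G. d g \<noteq> 0\<^sub>m m m}"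

definition is_decomposition :: "'f mat \<Rightarrow> ('g \<Rightarrow> 'f mat) \<Rightarrow> bool" where
  "is_decomposition a d \<longleftrightarrow> d \<in> (\<Pi>\<^sub>E g\<in>carrier G. \<A> g) \<and> finite (supp d) \<and>
     a = lincomb m (supp d) (\<lambda>_. 1) d"

definition component :: "'f mat \<Rightarrow> 'g \<Rightarrow> 'f mat" where
  "component a = (THE d. is_decomposition a d)"

lemma ex1_decomposition:
  assumes "a \<in> U"
  shows "\<exists>!d. is_decomposition a d"
proof -
  have "is_decomposition a d \<longleftrightarrow> d \<in> (\<Pi>\<^sub>E g\<in>carrier G. \<A> g) \<and>
        finite {g\<in>carrier G. d g \<noteq> \<zero>\<^bsub>UT m\<^esub>} \<and>
        a = finsum (UT m) d {g\<in>carrier G. d g \<noteq> \<zero>\<^bsub>UT m\<^esub>}" for d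
  proof -
    have "finsum (UT m) d {g\<in>carrier G. d g \<noteq> 0\<^sub>m m m}
        = lincomb m {g\<in>carrier G. d g \<noteq> 0\<^sub>m m m} (\<lambda>_. 1) d"
      if "d \<in> (\<Pi>\<^sub>E g\<in>carrier G. \<A> g)" "finite {g\<in>carrier G. d g \<noteq> 0\<^sub>m m m}"
      using that \<A>_U by (intro finsum_UT) auto
    then show ?thesis unfolding is_decomposition_def supp_def zero_UT by auto
  qed
  then show ?thesis using grading_\<A> assms unfolding grading_def by simp
qed

lemma is_decomposition_component: "a \<in> U \<Longrightarrow> is_decomposition a (component a)"
  unfolding component_def by (rule theI'[OF ex1_decomposition])

lemma component_\<A>: "\<lbrakk>a \<in> U; g \<in> carrier G\<rbrakk> \<Longrightarrow> component a g \<in> \<A> g"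
  and finite_supp_component: "a \<in> U \<Longrightarrow> finite (supp (component a))"
  and sum_components: "a \<in> U \<Longrightarrow> a = lincomb m (supp (component a)) (\<lambda>_. 1) (component a)"
  using is_decomposition_component[of a] by (auto simp: is_decomposition_def)

lemma component_U: "\<lbrakk>a \<in> U; g \<in> carrier G\<rbrakk> \<Longrightarrow> component a g \<in> U"
  using component_\<A> \<A>_U by blast

lemma sum_components_superset:
  assumes "a \<in> U" "finite S" "supp (component a) \<subseteq> S" "S \<subseteq> carrier G" "r < m" "c < m"
  shows "a $$ (r, c) = (\<Sum>g\<in>S. component a g $$ (r, c))"
proof -
  have "a $$ (r, c) = (\<Sum>g\<in>supp (component a). component a g $$ (r, c))"
    using arg_cong[OF sum_components[OF assms(1)], of "\<lambda>a. a $$ (r, c)"] assms by simp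
  also have "\<dots> = (\<Sum>g\<in>S. component a g $$ (r, c))"
    using assms by (intro sum.mono_neutral_left) (auto simp: supp_def)
  finally show ?thesis .
qed

lemma component_unique:
  assumes a: "a \<in> U" and d: "\<And>g. g \<in> carrier G \<Longrightarrow> d g \<in> \<A> g"
    and S: "finite S" "S \<subseteq> carrier G" "\<And>g. g \<in> carrier G \<Longrightarrow> g \<notin> S \<Longrightarrow> d g = 0\<^sub>m m m"
    and sum: "\<And>r c. \<lbrakk>r < m; c < m\<rbrakk> \<Longrightarrow> a $$ (r, c) = (\<Sum>g\<in>S. d g $$ (r, c))"
    and g: "g \<in> carrier G"
  shows "component a g = d g"
proof -
  \<comment> \<open>Decompositions are extensional on \<open>carrier G\<close>, so uniqueness speaks
    only about the restriction of \<open>d\<close>.\<close>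
  let ?d = "restrict d (carrier G)"
  have supp: "supp ?d \<subseteq> S" using S(3) by (auto simp: supp_def)
  have "a = lincomb m (supp ?d) (\<lambda>_. 1) ?d"
  proof (rule eq_matI)
    fix r c assume "r < dim_row (lincomb m (supp ?d) (\<lambda>_. 1) ?d)"
      "c < dim_col (lincomb m (supp ?d) (\<lambda>_. 1) ?d)"
    then have rc: "r < m" "c < m" by auto
    have "(\<Sum>g\<in>supp ?d. ?d g $$ (r, c)) = (\<Sum>g\<in>S. d g $$ (r, c))"
      using S rc supp by (intro sum.mono_neutral_cong_left) (auto simp: supp_def)
    then show "a $$ (r, c) = lincomb m (supp ?d) (\<lambda>_. 1) ?d $$ (r, c)"
      using sum[OF rc] rc by simp
  qed (use UT_dim[OF a] in auto)
  moreover have "finite (supp ?d)" using S(1) supp by (rule rev_finite_subset)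
  ultimately have "is_decomposition a ?d" using d by (simp add: is_decomposition_def)
  then have "component a = ?d"
    using ex1_decomposition[OF a] is_decomposition_component[OF a] by blast
  then show ?thesis using g by simp
qed

lemma component_lincomb:
  assumes T: "finite T" "\<And>t. t \<in> T \<Longrightarrow> M t \<in> U" and g: "g \<in> carrier G"
  shows "component (lincomb m T c M) g = lincomb m T c (\<lambda>t. component (M t) g)"
proof (rule component_unique[where S = "\<Union>t\<in>T. supp (component (M t))"])
  let ?S = "\<Union>t\<in>T. supp (component (M t))"
  show S: "finite ?S" using T finite_supp_component by auto
  show sub: "?S \<subseteq> carrier G" by (auto simp: supp_def)
  show "lincomb m T c M \<in> U" using T by (intro UT_lincomb)
  show "lincomb m T c (\<lambda>t. component (M t) h) \<in> \<A> h" if "h \<in> carrier G" for h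
    using that T by (intro linear_subspace_lincomb subspace_\<A> component_\<A>)
  show "lincomb m T c (\<lambda>t. component (M t) h) = 0\<^sub>m m m"
    if "h \<in> carrier G" "h \<notin> ?S" for h
    using that by (intro eq_matI) (auto simp: supp_def intro!: sum.neutral)
  fix r s assume rs: "r < m" "s < m"
  have "lincomb m T c M $$ (r, s) = (\<Sum>t\<in>T. c t * (\<Sum>h\<in>?S. component (M t) h $$ (r, s)))"
    using rs S sub T by (simp, intro sum.cong refl arg_cong2[where f = times] sum_components_superset) auto
  also have "\<dots> = (\<Sum>h\<in>?S. \<Sum>t\<in>T. c t * component (M t) h $$ (r, s))"
    unfolding sum_distrib_left by (rule sum.swap)
  finally show "lincomb m T c M $$ (r, s)
      = (\<Sum>h\<in>?S. lincomb m T c (\<lambda>t. component (M t) h) $$ (r, s))"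
    using rs by simp
qed (rule g)

lemma component_zero: "g \<in> carrier G \<Longrightarrow> component (0\<^sub>m m m) g = 0\<^sub>m m m"
  using component_lincomb[of "{}" "\<lambda>_. 0\<^sub>m m m" g "\<lambda>_. 0"] by (simp add: lincomb_empty)

text \<open>Expanding both factors into components and collecting the pairs by the product of their
  degrees gives a homogeneous decomposition of \<open>a * b\<close>, and decompositions are unique.
  The finite supports keep \<open>P g\<close> finite even if \<open>G\<close> is infinite.\<close>

lemma component_mult:
  assumes a: "a \<in> U" and b: "b \<in> U" and g: "g \<in> carrier G"
  defines "P \<equiv> \<lambda>g. {(h, k) \<in> supp (component a) \<times> supp (component b). h \<otimes>\<^bsub>G\<^esub> k = g}"
  shows "component (a * b) g = lincomb m (P g) (\<lambda>_. 1) (\<lambda>(h, k). component a h * component b k)"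
proof -
  let ?A = "supp (component a)" and ?B = "supp (component b)"
  let ?S = "(\<lambda>(h, k). h \<otimes>\<^bsub>G\<^esub> k) ` (?A \<times> ?B)"
  let ?f = "\<lambda>(h, k). component a h * component b k"
  have fin: "finite ?A" "finite ?B" using a b finite_supp_component by auto
  have sub: "?A \<subseteq> carrier G" "?B \<subseteq> carrier G" by (auto simp: supp_def)
  have finP: "finite (P h)" for h
    by (rule finite_subset[of _ "?A \<times> ?B"]) (use fin in \<open>auto simp: P_def\<close>)
  show ?thesis
  proof (rule component_unique[where S = ?S])
    show "a * b \<in> U" using a b by (rule UT_mult)
    show "finite ?S" "?S \<subseteq> carrier G" using fin sub by auto
    show "lincomb m (P h) (\<lambda>_. 1) ?f \<in> \<A> h" if h: "h \<in> carrier G" for h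
      using sub by (intro linear_subspace_lincomb subspace_\<A> h finP)
        (auto simp: P_def intro!: \<A>_mult component_\<A> a b)
    show "lincomb m (P h) (\<lambda>_. 1) ?f = 0\<^sub>m m m" if "h \<notin> ?S" for h
    proof -
      have "P h = {}" using that by (auto simp: P_def)
      then show ?thesis by (simp add: lincomb_empty)
    qed
    fix r c assume rc: "r < m" "c < m"
    have ab: "a $$ (r', c') = (\<Sum>h\<in>?A. component a h $$ (r', c'))"
      "b $$ (r', c') = (\<Sum>h\<in>?B. component b h $$ (r', c'))" if "r' < m" "c' < m" for r' c'
      using that a b fin sub by (auto intro!: sum_components_superset)
    have "(a * b) $$ (r, c) = (\<Sum>l<m. a $$ (r, l) * b $$ (l, c))"
      by (rule index_mult_sum[OF UT_dim[OF a] UT_dim[OF b] rc])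
    also have "\<dots> = (\<Sum>l<m. \<Sum>(h, k)\<in>?A \<times> ?B. component a h $$ (r, l) * component b k $$ (l, c))"
      using rc by (intro sum.cong refl) (simp add: ab sum_product sum.cartesian_product)
    also have "\<dots> = (\<Sum>(h, k)\<in>?A \<times> ?B. \<Sum>l<m. component a h $$ (r, l) * component b k $$ (l, c))"
      unfolding case_prod_unfold by (rule sum.swap)
    also have "\<dots> = (\<Sum>x\<in>?A \<times> ?B. ?f x $$ (r, c))"
      using sub rc a b
      by (intro sum.cong refl) (auto intro!: index_mult_sum[symmetric] UT_dim component_U)
    also have "\<dots> = (\<Sum>g\<in>?S. \<Sum>x\<in>P g. ?f x $$ (r, c))"
      using fin by (subst sum.image_gen[where g = "\<lambda>(h, k). h \<otimes>\<^bsub>G\<^esub> k"])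
        (auto simp: P_def intro!: sum.cong)
    finally show "(a * b) $$ (r, c) = (\<Sum>g\<in>?S. lincomb m (P g) (\<lambda>_. 1) ?f $$ (r, c))"
      using rc by simp
  qed (rule g)
qed

text \<open>A multiplicative functional cannot see the order of the factors of a homogeneous component,
  because \<open>G\<close> is abelian; and \<open>e\<^sub>j\<^sub>k = e\<^sub>j\<^sub>j e\<^sub>j\<^sub>k\<close> while \<open>e\<^sub>j\<^sub>k e\<^sub>j\<^sub>j = 0\<close>.\<close>

lemma character_component_unit:
  assumes lin: "\<And>T c (M :: 'g \<times> 'g \<Rightarrow> 'f mat). \<lbrakk>finite T; \<And>t. t \<in> T \<Longrightarrow> M t \<in> U\<rbrakk> \<Longrightarrow>
        \<psi> (lincomb m T c M) = (\<Sum>t\<in>T. c t * \<psi> (M t) :: 'f)"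
    and mult: "\<And>a b. \<lbrakk>a \<in> U; b \<in> U\<rbrakk> \<Longrightarrow> \<psi> (a * b) = \<psi> a * \<psi> b"
    and jk: "j < k" "k < m" and g: "g \<in> carrier G"
  shows "\<psi> (component (unit_mat m (j, k)) g) = 0"
proof -
  define P where "P a b = {(h, k) \<in> supp (component a) \<times> supp (component b). h \<otimes>\<^bsub>G\<^esub> k = g}"
    for a b :: "'f mat"
  have \<psi>: "\<psi> (component (a * b) g) = (\<Sum>(h, k)\<in>P a b. \<psi> (component a h) * \<psi> (component b k))"
    if a: "a \<in> U" and b: "b \<in> U" for a b
  proof -
    have "finite (P a b)"
      by (rule finite_subset[of _ "supp (component a) \<times> supp (component b)"])
        (use finite_supp_component[OF a] finite_supp_component[OF b] in \<open>auto simp: P_def\<close>)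
    moreover have "P a b \<subseteq> carrier G \<times> carrier G" by (auto simp: P_def supp_def)
    ultimately show ?thesis
      unfolding component_mult[OF a b g] P_def[symmetric] using a b
      by (subst lin) (auto intro!: UT_mult component_U sum.cong mult)
  qed
  let ?a = "unit_mat m (j, j) :: 'f mat" and ?b = "unit_mat m (j, k) :: 'f mat"
  have "\<psi> (component ?b g) = (\<Sum>(h, k)\<in>P ?a ?b. \<psi> (component ?a h) * \<psi> (component ?b k))"
    using \<psi>[of ?a ?b] by (simp add: UT_unit_mat unit_mat_mult(1)[OF jk])
  also have "\<dots> = (\<Sum>(h, k)\<in>P ?b ?a. \<psi> (component ?b h) * \<psi> (component ?a k))"
    by (rule sum.reindex_bij_witness[of _ prod.swap prod.swap])
      (auto simp: P_def supp_def G.m_comm mult.commute)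
  also have "\<dots> = \<psi> (component (0\<^sub>m m m) g)"
    using \<psi>[of ?b ?a] by (simp add: UT_unit_mat unit_mat_mult(2)[OF jk])
  also have "\<dots> = 0"
    using lin[of "{}" "\<lambda>_. 0\<^sub>m m m" "\<lambda>_. 0"] by (simp add: component_zero g lincomb_empty)
  finally show ?thesis .
qed

text \<open>The multiplicative functionals used are the diagonal entries of \<open>a\<close> and
  those of \<open>star a\<close>. The latter are multiplicative too: \<open>star\<close> reverses
  products, but the diagonal entries commute in the field.\<close>

lemma radical_level_component_unit:
  assumes "j < k" "k < m" "g \<in> carrier G"
  shows "radical_level m 1 (component (unit_mat m (j, k)) g)"
    and "radical_level m 1 (star (component (unit_mat m (j, k)) g))"
proof -
  have U: "component (unit_mat m (j, k)) g \<in> U" by (intro component_U UT_unit_mat assms)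
  show "radical_level m 1 (component (unit_mat m (j, k)) g)"
    by (rule radical_level_1[OF U], rule character_component_unit[where \<psi> = "\<lambda>a. a $$ (i, i)" for i])
      (use assms in \<open>auto simp: UT_diag_mult\<close>)
  show "radical_level m 1 (star (component (unit_mat m (j, k)) g))"
    by (rule radical_level_1[OF star_U[OF U]],
        rule character_component_unit[where \<psi> = "\<lambda>a. star a $$ (i, i)" for i])
      (use assms in \<open>auto simp: star_mult UT_diag_mult[OF star_U star_U] mult.commute
        involution_lincomb[OF star_involution]\<close>)
qed

end

section \<open>Reduction to tuples of matrix units\<close>

interpretation star_poly: vector_space "poly_scale :: 'f::field \<Rightarrow> ('g, 'f) star_poly \<Rightarrow> _"
  by (rule vector_space_poly_scale)

primrec var_index :: "'g indet \<Rightarrow> nat" where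
  "var_index (Var i g \<delta>) = i"

primrec var_degree :: "'g indet \<Rightarrow> 'g" where
  "var_degree (Var i g \<delta>) = g"

lemma indets_degree: "x \<in> indets G \<longleftrightarrow> var_degree x \<in> carrier G"
  by (cases x) (auto simp: indets_def)

lemma multilinear_wordsE:
  assumes "w \<in> multilinear_words G n"
  shows "set w \<subseteq> indets G" "distinct (map var_index w)" "var_index ` set w = {1..n}"
proof -
  obtain \<sigma> g \<delta> where w: "w = map (\<lambda>k. Var (\<sigma> k) (g k) (\<delta> k)) [1..<Suc n]"
    and \<sigma>: "\<sigma> permutes {1..n}" and g: "g \<in> {1..n} \<rightarrow> carrier G"
    using assms by (auto simp: multilinear_words_def)
  have idx: "map var_index w = map \<sigma> [1..<Suc n]" unfolding w by (simp add: o_def)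
  have set: "set [1..<Suc n] = {1..n}" by auto
  show "set w \<subseteq> indets G" using g unfolding w by (auto simp: indets_def)
  show "distinct (map var_index w)"
    unfolding idx distinct_map set using permutes_inj_on[OF \<sigma>] by simp
  have "set (map var_index w) = {1..n}"
    unfolding idx set_map set by (rule permutes_image[OF \<sigma>])
  then show "var_index ` set w = {1..n}" by simp
qed

lemma subspace_keys: "star_poly.subspace {p :: ('g, 'f::field) star_poly. Poly_Mapping.keys p \<subseteq> X}"
proof -
  have "{p :: ('g, 'f) star_poly. Poly_Mapping.keys p \<subseteq> X} = {p. \<forall>w. w \<notin> X \<longrightarrow> Poly_Mapping.lookup p w = 0}"
    by (auto simp: in_keys_iff subset_eq)
  then show ?thesis by (auto simp: star_poly.subspace_def lookup_add)
qed

lemma keys_multilinear_polys: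
  fixes p :: "('g, 'f::field) star_poly"
  assumes "p \<in> multilinear_polys G n"
  shows "Poly_Mapping.keys p \<subseteq> multilinear_words G n"
proof -
  have "multilinear_polys G n \<subseteq> {p :: ('g, 'f) star_poly. Poly_Mapping.keys p \<subseteq> multilinear_words G n}"
    unfolding multilinear_polys_def
    by (rule star_poly.span_minimal[OF _ subspace_keys]) auto
  then show ?thesis using assms by blast
qed

lemma multilinear_polys_free:
  "multilinear_polys G n \<subseteq> (free_star_algebra G :: ('g, 'f::field) star_poly set)"
proof
  fix p :: "('g, 'f) star_poly" assume "p \<in> multilinear_polys G n"
  from keys_multilinear_polys[OF this] show "p \<in> free_star_algebra G"
    unfolding free_star_algebra_def using multilinear_wordsE(1)[of _ G n] by fastforce
qed

context graded_UT
begin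

section \<open>Values of words and their multilinearity\<close>

definition admissible :: "(nat \<Rightarrow> 'g \<Rightarrow> 'f mat) \<Rightarrow> bool" where
  "admissible \<phi> \<longleftrightarrow> (\<forall>i. \<forall>g\<in>carrier G. \<phi> i g \<in> \<A> g)"

abbreviation word_val :: "(nat \<Rightarrow> 'g \<Rightarrow> 'f mat) \<Rightarrow> 'g indet list \<Rightarrow> 'f mat" where
  "word_val \<equiv> word_value (UT m) star"

lemma word_val_Nil: "word_val \<phi> [] = 1\<^sub>m m"
  and word_val_Cons: "word_val \<phi> (x # w) = indet_value star \<phi> x * word_val \<phi> w"
  by (simp_all add: word_value_def)

lemma indet_value_U:
  assumes "admissible \<phi>" "x \<in> indets G"
  shows "indet_value star \<phi> x \<in> U"
proof (cases x)
  case (Var i g \<delta>)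
  then have "g \<in> carrier G" "\<phi> i g \<in> \<A> g" using assms by (auto simp: admissible_def indets_degree)
  then show ?thesis using Var \<A>_U star_U by auto
qed

lemma word_val_U: "\<lbrakk>admissible \<phi>; set w \<subseteq> indets G\<rbrakk> \<Longrightarrow> word_val \<phi> w \<in> U"
  by (induction w) (auto simp: word_val_Nil word_val_Cons UT_one intro!: UT_mult indet_value_U)

lemma word_val_cong:
  assumes "\<And>i g. i \<in> var_index ` set w \<Longrightarrow> \<phi> i g = \<phi>' i g"
  shows "word_val \<phi> w = word_val \<phi>' w"
  using assms
proof (induction w)
  case (Cons x w)
  then show ?case by (cases x) (auto simp: word_val_Cons)
qed (simp add: word_val_Nil)

text \<open>Linearity in the one factor of index \<open>i\<close>, which may be starred. The
  coefficients \<open>c\<close> do not depend on the degree \<open>g\<close>: the same expansion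
  must serve all words of a polynomial, in which the index \<open>i\<close> may carry different
  degrees.\<close>

lemma word_val_slot:
  assumes w: "set w \<subseteq> indets G" "distinct (map var_index w)" "i \<in> var_index ` set w"
    and \<phi>: "admissible \<phi>" and \<psi>: "\<And>t g. \<lbrakk>t \<in> T; g \<in> carrier G\<rbrakk> \<Longrightarrow> \<psi> t g \<in> \<A> g" and T: "finite T"
    and slot: "\<And>g. g \<in> var_degree ` set w \<Longrightarrow> \<phi> i g = lincomb m T c (\<lambda>t. \<psi> t g)"
    and rs: "r < m" "s < m"
  shows "word_val \<phi> w $$ (r, s) = (\<Sum>t\<in>T. c t * word_val (\<phi>(i := \<psi> t)) w $$ (r, s))"
  using w slot rs(1)
proof (induction w arbitrary: r)
  case (Cons x w)
  have x: "x \<in> indets G" and w: "set w \<subseteq> indets G" using Cons.prems by auto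
  have adm: "admissible (\<phi>(i := \<psi> t))" if "t \<in> T" for t
    using \<phi> \<psi> that by (auto simp: admissible_def)
  have val: "indet_value star \<phi> x \<in> carrier_mat m m" "word_val \<phi> w \<in> carrier_mat m m"
    by (intro UT_dim indet_value_U word_val_U \<phi> x w)+
  have val_t: "indet_value star (\<phi>(i := \<psi> t)) x \<in> carrier_mat m m"
    "word_val (\<phi>(i := \<psi> t)) w \<in> carrier_mat m m" if "t \<in> T" for t
    using that by (intro UT_dim indet_value_U word_val_U adm x w; assumption)+
  show ?case
  proof (cases "var_index x = i")
    case True
    then obtain g \<delta> where xg: "x = Var i g \<delta>" by (cases x) auto
    have g: "g \<in> carrier G" using x xg by (simp add: indets_degree)
    have \<psi>U: "\<psi> t g \<in> U" if "t \<in> T" for t using \<psi> \<A>_U g that by blast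
    have "i \<notin> var_index ` set w" using Cons.prems(2) xg by auto
    then have rest: "word_val (\<phi>(i := \<psi> t)) w = word_val \<phi> w" for t
      by (intro word_val_cong) auto
    have "\<phi> i g = lincomb m T c (\<lambda>t. \<psi> t g)" using Cons.prems(4) xg by simp
    then have "indet_value star \<phi> x = lincomb m T c (\<lambda>t. indet_value star (\<phi>(i := \<psi> t)) x)"
      using involution_lincomb[OF star_involution T \<psi>U, where c = c] xg by simp
    then have x_lincomb: "indet_value star \<phi> x $$ (r, l) = (\<Sum>t\<in>T. c t * indet_value star (\<phi>(i := \<psi> t)) x $$ (r, l))"
      if "l < m" for l
      using Cons.prems(5) that by simp
    have "word_val \<phi> (x # w) $$ (r, s) = (\<Sum>l<m.
        (\<Sum>t\<in>T. c t * indet_value star (\<phi>(i := \<psi> t)) x $$ (r, l)) * word_val \<phi> w $$ (l, s))"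
      unfolding word_val_Cons index_mult_sum[OF val Cons.prems(5) rs(2)]
      by (simp add: x_lincomb)
    also have "\<dots> = (\<Sum>t\<in>T. c t * (\<Sum>l<m. indet_value star (\<phi>(i := \<psi> t)) x $$ (r, l) * word_val \<phi> w $$ (l, s)))"
      by (simp add: sum_distrib_right sum_distrib_left mult.assoc) (rule sum.swap)
    also have "\<dots> = (\<Sum>t\<in>T. c t * word_val (\<phi>(i := \<psi> t)) (x # w) $$ (r, s))"
      unfolding word_val_Cons rest using Cons.prems(5) rs(2) val val_t
      by (intro sum.cong refl) (simp add: index_mult_sum[of _ m])
    finally show ?thesis .
  next
    case False
    have x': "indet_value star (\<phi>(i := \<psi> t)) x = indet_value star \<phi> x" for t
      using False by (cases x) auto
    have IH: "word_val \<phi> w $$ (l, s) = (\<Sum>t\<in>T. c t * word_val (\<phi>(i := \<psi> t)) w $$ (l, s))"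
      if "l < m" for l
      using Cons.prems False that by (intro Cons.IH) auto
    have "word_val \<phi> (x # w) $$ (r, s)
      = (\<Sum>l<m. indet_value star \<phi> x $$ (r, l) * (\<Sum>t\<in>T. c t * word_val (\<phi>(i := \<psi> t)) w $$ (l, s)))"
      unfolding word_val_Cons index_mult_sum[OF val Cons.prems(5) rs(2)] by (simp add: IH)
    also have "\<dots> = (\<Sum>t\<in>T. c t * (\<Sum>l<m. indet_value star \<phi> x $$ (r, l) * word_val (\<phi>(i := \<psi> t)) w $$ (l, s)))"
      by (simp add: sum_distrib_left mult_ac) (rule sum.swap)
    also have "\<dots> = (\<Sum>t\<in>T. c t * word_val (\<phi>(i := \<psi> t)) (x # w) $$ (r, s))"
      unfolding word_val_Cons x' using Cons.prems(5) rs(2) val val_t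
      by (intro sum.cong refl) (simp add: index_mult_sum[of _ m])
    finally show ?thesis .
  qed
qed simp

text \<open>A matrix entry of the value of \<open>p\<close>, written as a sum in the field so that
  it is a linear functional on all polynomials, without any restriction on \<open>p\<close> or
  \<open>\<phi>\<close>.\<close>

definition ev :: "(nat \<Rightarrow> 'g \<Rightarrow> 'f mat) \<Rightarrow> nat \<times> nat \<Rightarrow> ('g, 'f) star_poly \<Rightarrow> 'f" where
  "ev \<phi> rc p = (\<Sum>w\<in>Poly_Mapping.keys p. Poly_Mapping.lookup p w * word_val \<phi> w $$ rc)"

lemma ev_superset:
  "\<lbrakk>finite X; Poly_Mapping.keys p \<subseteq> X\<rbrakk> \<Longrightarrow>
    ev \<phi> rc p = (\<Sum>w\<in>X. Poly_Mapping.lookup p w * word_val \<phi> w $$ rc)"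
  unfolding ev_def by (intro sum.mono_neutral_left) (auto simp: in_keys_iff)

lemma ev_single: "ev \<phi> rc (Poly_Mapping.single w c) = c * word_val \<phi> w $$ rc"
  by (subst ev_superset[of "{w}"]) auto

lemma linear_ev: "Vector_Spaces.linear poly_scale (*) (ev \<phi> rc)"
  unfolding Vector_Spaces.linear_iff
proof (intro conjI allI vector_space_poly_scale)
  show "vector_space ((*) :: 'f \<Rightarrow> _)" by unfold_locales (simp_all add: algebra_simps)
next
  fix p q :: "('g, 'f) star_poly" and c :: 'f
  let ?X = "Poly_Mapping.keys p \<union> Poly_Mapping.keys q"
  have "Poly_Mapping.keys (p + q) \<subseteq> ?X" by (rule keys_add)
  then show "ev \<phi> rc (p + q) = ev \<phi> rc p + ev \<phi> rc q"
    by (simp add: ev_superset[of ?X] lookup_add algebra_simps sum.distrib)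
  have "Poly_Mapping.keys (poly_scale c p) \<subseteq> Poly_Mapping.keys p" by (auto simp: in_keys_iff)
  then show "ev \<phi> rc (poly_scale c p) = c * ev \<phi> rc p"
    by (simp add: ev_superset[of "Poly_Mapping.keys p"] sum_distrib_left mult.assoc)
qed

lemma index_poly_value:
  assumes p: "p \<in> free_star_algebra G" and \<phi>: "admissible \<phi>" and rc: "r < m" "c < m"
  shows "poly_value (UT m) star \<phi> p $$ (r, c) = ev \<phi> (r, c) p"
    and "poly_value (UT m) star \<phi> p \<in> carrier_mat m m"
proof -
  have U: "word_val \<phi> w \<in> U" if "w \<in> Poly_Mapping.keys p" for w
    using p that \<phi> by (intro word_val_U) (auto simp: free_star_algebra_def)
  have smult: "k \<cdot>\<^sub>m word_val \<phi> w \<in> U" if "w \<in> Poly_Mapping.keys p" for w and k :: 'f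
    using UT_dim[OF U[OF that]] UT_lower_zero[OF U[OF that]] by (intro UT_I) auto
  have *: "poly_value (UT m) star \<phi> p = lincomb m (Poly_Mapping.keys p) (\<lambda>_. 1)
      (\<lambda>w. Poly_Mapping.lookup p w \<cdot>\<^sub>m word_val \<phi> w)"
    unfolding poly_value_def smult_UT by (intro finsum_UT smult) auto
  show "poly_value (UT m) star \<phi> p \<in> carrier_mat m m" unfolding * by simp
  show "poly_value (UT m) star \<phi> p $$ (r, c) = ev \<phi> (r, c) p"
    unfolding * ev_def index_lincomb[OF rc]
  proof (intro sum.cong refl)
    fix w assume "w \<in> Poly_Mapping.keys p"
    from UT_dim[OF U[OF this]]
    show "1 * (Poly_Mapping.lookup p w \<cdot>\<^sub>m word_val \<phi> w) $$ (r, c)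
        = Poly_Mapping.lookup p w * word_val \<phi> w $$ (r, c)"
      using rc by simp
  qed
qed

lemma star_identities_iff:
  assumes "p \<in> free_star_algebra G"
  shows "p \<in> star_identities G (UT m) \<A> star \<longleftrightarrow>
    (\<forall>\<phi>. admissible \<phi> \<longrightarrow> (\<forall>r<m. \<forall>c<m. ev \<phi> (r, c) p = 0))"
proof -
  have "poly_value (UT m) star \<phi> p = 0\<^sub>m m m \<longleftrightarrow> (\<forall>r<m. \<forall>c<m. ev \<phi> (r, c) p = 0)"
    if \<phi>: "admissible \<phi>" for \<phi>
  proof -
    have dim: "poly_value (UT m) star \<phi> p \<in> carrier_mat m m"
      by (rule index_poly_value(2)[OF assms \<phi> m_pos m_pos])
    have "poly_value (UT m) star \<phi> p = 0\<^sub>m m m"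
      if *: "\<forall>r<m. \<forall>c<m. ev \<phi> (r, c) p = 0"
    proof (rule eq_matI)
      fix r c assume "r < dim_row (0\<^sub>m m m :: 'f mat)" "c < dim_col (0\<^sub>m m m :: 'f mat)"
      then have rc: "r < m" "c < m" by simp_all
      show "poly_value (UT m) star \<phi> p $$ (r, c) = 0\<^sub>m m m $$ (r, c)"
        unfolding index_poly_value(1)[OF assms \<phi> rc] using * rc by simp
    qed (use dim in simp_all)
    moreover have "ev \<phi> (r, c) p = 0" if "poly_value (UT m) star \<phi> p = 0\<^sub>m m m" "r < m" "c < m" for r c
      using index_poly_value(1)[OF assms \<phi> that(2,3)] that by simp
    ultimately show ?thesis by blast
  qed
  then show ?thesis
    using assms unfolding star_identities_def admissible_def[symmetric] by simp
qed

definition unit_assignment :: "(nat \<Rightarrow> nat \<times> nat) \<Rightarrow> nat \<Rightarrow> 'g \<Rightarrow> 'f mat" where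
  "unit_assignment \<tau> i = component (unit_mat m (\<tau> i))"

lemma admissible_unit_assignment: "admissible (unit_assignment \<tau>)"
  by (auto simp: admissible_def unit_assignment_def intro!: component_\<A> UT_unit_mat)

section \<open>Unit tuples and the nilpotency of the radical\<close>

definition unit_tuples :: "nat \<Rightarrow> (nat \<Rightarrow> nat \<times> nat) set" where
  "unit_tuples n = {\<tau> \<in> {1..n} \<rightarrow>\<^sub>E unit_indices m. card {i\<in>{1..n}. fst (\<tau> i) < snd (\<tau> i)} < m}"

text \<open>Every variable carrying an off-diagonal unit raises the radical level by one, starred or
  not; the others leave it unchanged.\<close>

lemma radical_level_word_val:
  assumes "set w \<subseteq> indets G" "\<And>i. i \<in> var_index ` set w \<Longrightarrow> \<tau> i \<in> unit_indices m"
  shows "radical_level m (length (filter (\<lambda>i. fst (\<tau> i) < snd (\<tau> i)) (map var_index w)))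
    (word_val (unit_assignment \<tau>) w)"
  using assms
proof (induction w)
  case Nil
  show ?case by (simp add: word_val_Nil radical_level_0 UT_one)
next
  case (Cons x w)
  let ?\<phi> = "unit_assignment \<tau>"
  have IH: "radical_level m (length (filter (\<lambda>i. fst (\<tau> i) < snd (\<tau> i)) (map var_index w))) (word_val ?\<phi> w)"
    using Cons by simp
  obtain i g \<delta> where x: "x = Var i g \<delta>" by (cases x)
  have g: "g \<in> carrier G" using Cons.prems(1) x by (simp add: indets_degree)
  have "radical_level m (if fst (\<tau> i) < snd (\<tau> i) then 1 else 0) (indet_value star ?\<phi> x)"
  proof (cases "fst (\<tau> i) < snd (\<tau> i)")
    case True
    have "snd (\<tau> i) < m" using Cons.prems(2)[of i] x by (auto simp: unit_indices_def)
    from radical_level_component_unit[OF True this g] show ?thesis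
      using True by (simp add: x unit_assignment_def)
  next
    case False
    have "indet_value star ?\<phi> x \<in> U"
      using Cons.prems(1) by (intro indet_value_U admissible_unit_assignment) auto
    then show ?thesis using False by (simp add: radical_level_0)
  qed
  from radical_level_mult[OF this IH] show ?case by (simp add: word_val_Cons x split: if_splits)
qed

lemma word_val_many_radical:
  assumes w: "w \<in> multilinear_words G n" and \<tau>: "\<And>i. i \<in> {1..n} \<Longrightarrow> \<tau> i \<in> unit_indices m"
    and card: "m \<le> card {i\<in>{1..n}. fst (\<tau> i) < snd (\<tau> i)}" and rc: "r < m" "c < m"
  shows "word_val (unit_assignment \<tau>) w $$ (r, c) = 0"
proof -
  note w' = multilinear_wordsE[OF w]
  \<comment> \<open>Distinct indices turn the length of the filtered list into the number of
    off-diagonal units. This is at least \<open>m\<close>, and at radical level \<open>m\<close> or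
    more all entries vanish because \<open>c < m\<close>.\<close>
  have "length (filter (\<lambda>i. fst (\<tau> i) < snd (\<tau> i)) (map var_index w))
      = card (set (filter (\<lambda>i. fst (\<tau> i) < snd (\<tau> i)) (map var_index w)))"
    by (rule distinct_card[OF distinct_filter[OF w'(2)], symmetric])
  also have "set (filter (\<lambda>i. fst (\<tau> i) < snd (\<tau> i)) (map var_index w))
      = {i\<in>{1..n}. fst (\<tau> i) < snd (\<tau> i)}"
    unfolding w'(3)[symmetric] by (auto simp del: filter_map)
  finally show ?thesis
    using radical_level_word_val[OF w'(1), of \<tau>] \<tau> w'(3) card rc
    by (simp add: radical_level_def del: filter_map)
qed

text \<open>The variables are treated one at a time: \<open>I\<close> holds the indices whose values
  are still arbitrary, and expanding such a value in matrix units removes its index from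
  \<open>I\<close>. When \<open>I\<close> is empty, either the tuple belongs to
  \<open>unit_tuples\<close> or it has so many off-diagonal units that every word vanishes.\<close>

lemma ev_zero_of_unit_tuples:
  assumes p: "p \<in> multilinear_polys G n" and rc: "r < m" "c < m"
    and units: "\<And>\<tau>. \<tau> \<in> unit_tuples n \<Longrightarrow> ev (unit_assignment \<tau>) (r, c) p = 0"
    and \<phi>: "admissible \<phi>"
  shows "ev \<phi> (r, c) p = 0"
proof -
  note words = keys_multilinear_polys[OF p, THEN subsetD]
  have "ev \<phi> (r, c) p = 0"
    if "finite I" "I \<subseteq> {1..n}" "admissible \<phi>"
      "\<forall>i\<in>{1..n} - I. \<exists>t\<in>unit_indices m. \<phi> i = component (unit_mat m t)" for I \<phi>
    using that
  proof (induction I arbitrary: \<phi> rule: finite_induct)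
    case empty
    then obtain \<tau>' where \<tau>': "\<And>i. i \<in> {1..n} \<Longrightarrow> \<tau>' i \<in> unit_indices m \<and> \<phi> i = component (unit_mat m (\<tau>' i))"
      by (metis Diff_empty)
    define \<tau> where "\<tau> = restrict \<tau>' {1..n}"
    have \<tau>: "\<tau> \<in> {1..n} \<rightarrow>\<^sub>E unit_indices m" using \<tau>' by (auto simp: \<tau>_def)
    have eq: "word_val \<phi> w = word_val (unit_assignment \<tau>) w" if "w \<in> Poly_Mapping.keys p" for w
      using multilinear_wordsE(3)[OF words[OF that]] \<tau>'
      by (intro word_val_cong) (simp add: unit_assignment_def \<tau>_def)
    then have eq': "ev \<phi> (r, c) p = ev (unit_assignment \<tau>) (r, c) p" by (simp add: ev_def)
    show ?case
    proof (cases "\<tau> \<in> unit_tuples n")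
      case True
      then show ?thesis using units eq' by simp
    next
      case False
      then have "m \<le> card {i\<in>{1..n}. fst (\<tau> i) < snd (\<tau> i)}" using \<tau> by (simp add: unit_tuples_def)
      then have "word_val (unit_assignment \<tau>) w $$ (r, c) = 0" if "w \<in> Poly_Mapping.keys p" for w
        using \<tau> rc by (intro word_val_many_radical[OF words[OF that]]) auto
      then show ?thesis unfolding eq' by (simp add: ev_def)
    qed
  next
    case (insert i I)
    \<comment> \<open>Only the finitely many degrees \<open>S\<close> occurring in \<open>p\<close>
      matter. Adding the values \<open>\<phi> i g\<close> over \<open>S\<close> packs them into one
      matrix \<open>a\<close>, whose components return them; the entries of \<open>a\<close> are
      therefore expansion coefficients common to all these degrees.\<close>
    define S where "S = (\<Union>w\<in>Poly_Mapping.keys p. var_degree ` set w)"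
    have S: "finite S" "S \<subseteq> carrier G"
      using multilinear_wordsE(1)[OF words] by (fastforce simp: S_def indets_degree)+
    define a where "a = lincomb m S (\<lambda>_. 1) (\<phi> i)"
    have \<phi>\<A>: "\<phi> i g \<in> \<A> g" if "g \<in> carrier G" for g using insert.prems(2) that by (simp add: admissible_def)
    have a: "a \<in> U" unfolding a_def using \<phi>\<A> \<A>_U S(2) by (intro UT_lincomb) blast
    have \<phi>i: "\<phi> i g = lincomb m (unit_indices m) (\<lambda>t. a $$ t) (\<lambda>t. component (unit_mat m t) g)"
      if g: "g \<in> S" for g
    proof -
      have gG: "g \<in> carrier G" using g S by blast
      have "component a g = (if g \<in> S then \<phi> i g else 0\<^sub>m m m)"
        using S \<phi>\<A> \<A>_zero gG
        by (intro component_unique[OF a, where S = S]) (auto simp: a_def intro!: sum.cong)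
      then have "\<phi> i g = component a g" using g by simp
      also have "\<dots> = component (lincomb m (unit_indices m) (\<lambda>t. a $$ t) (unit_mat m)) g"
        using UT_unit_expansion[OF a] by simp
      also have "\<dots> = lincomb m (unit_indices m) (\<lambda>t. a $$ t) (\<lambda>t. component (unit_mat m t) g)"
        using gG by (intro component_lincomb UT_unit_mat) auto
      finally show ?thesis .
    qed
    have "word_val \<phi> w $$ (r, c) = (\<Sum>t\<in>unit_indices m. a $$ t *
        word_val (\<phi>(i := component (unit_mat m t))) w $$ (r, c))" if w: "w \<in> Poly_Mapping.keys p" for w
    proof (rule word_val_slot)
      show "set w \<subseteq> indets G" "distinct (map var_index w)" "i \<in> var_index ` set w"
        using multilinear_wordsE[OF words[OF w]] insert.prems(1) by simp_all
      show "\<phi> i g = lincomb m (unit_indices m) (\<lambda>t. a $$ t) (\<lambda>t. component (unit_mat m t) g)"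
        if "g \<in> var_degree ` set w" for g
        using that w by (intro \<phi>i) (auto simp: S_def)
    qed (use insert.prems(2) rc in \<open>auto intro!: component_\<A> UT_unit_mat\<close>)
    then have "ev \<phi> (r, c) p = (\<Sum>w\<in>Poly_Mapping.keys p. \<Sum>t\<in>unit_indices m. a $$ t *
        (Poly_Mapping.lookup p w * word_val (\<phi>(i := component (unit_mat m t))) w $$ (r, c)))"
      unfolding ev_def by (simp add: sum_distrib_left mult_ac)
    also have "\<dots> = (\<Sum>t\<in>unit_indices m. a $$ t * ev (\<phi>(i := component (unit_mat m t))) (r, c) p)"
      unfolding ev_def sum_distrib_left by (rule sum.swap)
    also have "\<dots> = 0"
    proof (intro sum.neutral ballI)
      fix t assume t: "t \<in> unit_indices m"
      have "ev (\<phi>(i := component (unit_mat m t))) (r, c) p = 0"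
        using insert.prems t
        by (intro insert.IH) (auto simp: admissible_def intro!: component_\<A> UT_unit_mat)
      then show "a $$ t * ev (\<phi>(i := component (unit_mat m t))) (r, c) p = 0" by simp
    qed
    finally show ?case .
  qed
  from this[of "{1..n}"] \<phi> show ?thesis by simp
qed

end

section \<open>Separated words\<close>

text \<open>For a list \<open>ts\<close> of unit positions, this is the condition for the product of
  the corresponding matrix units to have entry 1 at \<open>(r, c)\<close>; otherwise that entry is
  0. The empty product is the identity matrix.\<close>

primrec unit_path :: "nat \<Rightarrow> (nat \<times> nat) list \<Rightarrow> nat \<Rightarrow> bool" where
  "unit_path r [] c \<longleftrightarrow> r = c"
| "unit_path r (t # ts) c \<longleftrightarrow> r = fst t \<and> unit_path (snd t) ts c"

text \<open>The variable indices of the word \<open>X\<^sub>0 y\<^sub>1 X\<^sub>1 \<dots> y\<^sub>j X\<^sub>j\<close>: \<open>y\<^sub>k\<close> has index \<open>N + k\<close>, and \<open>X\<^sub>k\<close> collects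
  the \<open>i \<le> N\<close> with \<open>f i = k\<close>.\<close>

primrec block_list :: "nat \<Rightarrow> (nat \<Rightarrow> nat) \<Rightarrow> nat \<Rightarrow> nat list" where
  "block_list N f 0 = filter (\<lambda>i. f i = 0) [1..<Suc N]"
| "block_list N f (Suc j) = block_list N f j @ (N + Suc j) # filter (\<lambda>i. f i = Suc j) [1..<Suc N]"

text \<open>For \<open>i = N + k\<close> with \<open>k \<ge> 1\<close> the value is
  \<open>(k - 1, k)\<close>, the position assigned to the separator with number \<open>k\<close>;
  \<open>h\<close> selects the diagonal units for the other variables.\<close>

definition block_unit :: "nat \<Rightarrow> (nat \<Rightarrow> nat) \<Rightarrow> nat \<Rightarrow> nat \<times> nat" where
  "block_unit N h i = (if i \<le> N then (h i, h i) else (i - Suc N, i - N))"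

lemma set_block_list: "set (block_list N f j) = {i\<in>{1..N}. f i \<le> j} \<union> {N + 1..N + j}"
proof (induction j)
  case (Suc j)
  have "i \<in> set (block_list N f (Suc j)) \<longleftrightarrow> i \<in> {i\<in>{1..N}. f i \<le> Suc j} \<union> {N + 1..N + Suc j}" for i
    unfolding block_list.simps set_append list.set Suc.IH set_filter set_upt
    by (cases "f i = Suc j") (simp_all, linarith+)
  then show ?case by blast
qed (simp add: set_eq_iff, linarith)

lemma distinct_block_list: "distinct (block_list N f j)"
proof (induction j)
  case (Suc j)
  then show ?case by (simp add: set_block_list del: upt_Suc) force
qed (simp del: upt_Suc)

lemma unit_path_loops:
  assumes "\<And>i. i \<in> set is \<Longrightarrow> \<tau> i = (h i, h i)"
  shows "unit_path r (map \<tau> is @ ts) c \<longleftrightarrow> (\<forall>i\<in>set is. h i = r) \<and> unit_path r ts c"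
  using assms
proof (induction "is")
  case (Cons i "is")
  then have "\<tau> i = (h i, h i)" by simp
  with Cons show ?case by (cases "h i = r") (simp_all add: eq_commute)
qed simp

text \<open>Diagonal units are loops and only the separators move the path forward, so block
  \<open>k\<close> is read at node \<open>k\<close> and forces \<open>h\<close> to equal
  \<open>k\<close> on it. The tail \<open>ts\<close> makes the induction work, since
  \<open>block_list\<close> grows at its right end.\<close>

lemma unit_path_block_list:
  "unit_path 0 (map (block_unit N h) (block_list N f j) @ ts) c \<longleftrightarrow>
    (\<forall>i\<in>{1..N}. f i \<le> j \<longrightarrow> h i = f i) \<and> unit_path j ts c"
proof (induction j arbitrary: ts)
  case 0
  have "unit_path 0 (map (block_unit N h) (block_list N f 0) @ ts) c \<longleftrightarrow>
      (\<forall>i\<in>set (block_list N f 0). h i = 0) \<and> unit_path 0 ts c"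
    by (rule unit_path_loops) (auto simp: block_unit_def)
  moreover have "(\<forall>i\<in>set (block_list N f 0). h i = 0) \<longleftrightarrow> (\<forall>i\<in>{1..N}. f i \<le> 0 \<longrightarrow> h i = f i)"
    unfolding set_block_list by auto
  ultimately show ?case by (simp only:)
next
  case (Suc j)
  have loops: "unit_path (Suc j) (map (block_unit N h) (filter (\<lambda>i. f i = Suc j) [1..<Suc N]) @ ts) c \<longleftrightarrow>
      (\<forall>i\<in>set (filter (\<lambda>i. f i = Suc j) [1..<Suc N]). h i = Suc j) \<and> unit_path (Suc j) ts c"
    by (rule unit_path_loops) (auto simp: block_unit_def)
  have "block_unit N h (N + Suc j) = (j, Suc j)" by (simp add: block_unit_def)
  then have "unit_path 0 (map (block_unit N h) (block_list N f (Suc j)) @ ts) c \<longleftrightarrow>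
      (\<forall>i\<in>{1..N}. f i \<le> j \<longrightarrow> h i = f i) \<and>
      (\<forall>i\<in>set (filter (\<lambda>i. f i = Suc j) [1..<Suc N]). h i = Suc j) \<and> unit_path (Suc j) ts c"
    by (simp only: block_list.simps map_append list.map append.assoc append.simps Suc.IH
        unit_path.simps loops fst_conv snd_conv simp_thms)
  moreover have "(\<forall>i\<in>{1..N}. f i \<le> Suc j \<longrightarrow> h i = f i) \<longleftrightarrow>
      (\<forall>i\<in>{1..N}. f i \<le> j \<longrightarrow> h i = f i) \<and>
      (\<forall>i\<in>set (filter (\<lambda>i. f i = Suc j) [1..<Suc N]). h i = Suc j)"
    unfolding le_Suc_eq set_filter set_upt by fastforce
  ultimately show ?case by (simp only: conj_assoc)
qed

definition graded_word :: "nat list \<Rightarrow> (nat \<Rightarrow> 'g) \<Rightarrow> 'g indet list" where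
  "graded_word is \<gamma> = map (\<lambda>i. Var i (\<gamma> i) False) is"

text \<open>\<open>multilinear_words\<close> attaches degrees to positions,
  \<open>graded_word\<close> to variable indices; hence the passage from \<open>\<gamma>\<close> to
  \<open>\<gamma> \<circ> \<sigma>\<close>.\<close>

lemma graded_word_multilinear:
  assumes "distinct is" "set is = {1..n}" and \<gamma>: "\<gamma> \<in> {1..n} \<rightarrow> carrier G"
  shows "graded_word is \<gamma> \<in> multilinear_words G n"
proof -
  have len: "length is = n" using distinct_card[OF assms(1)] assms(2) by simp
  \<comment> \<open>Positions count from 1 and list entries from 0; outside \<open>{1..n}\<close> a
    permutation of that set must be the identity.\<close>
  define \<sigma> where "\<sigma> k = (if k \<in> {1..n} then is ! (k - 1) else k)" for k
  have "bij_betw (\<lambda>k. k - 1) {1..n} {..<n}"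
    by (rule bij_betw_byWitness[of _ Suc]) auto
  then have "bij_betw ((!) is \<circ> (\<lambda>k. k - 1)) {1..n} {1..n}"
    using bij_betw_nth[OF assms(1), of "{..<n}" "{1..n}"] len assms(2) by (auto intro: bij_betw_trans)
  then have "bij_betw \<sigma> {1..n} {1..n}"
    by (rule bij_betw_cong[THEN iffD1, rotated]) (simp add: \<sigma>_def)
  then have \<sigma>: "\<sigma> permutes {1..n}" by (rule bij_imp_permutes) (auto simp: \<sigma>_def)
  have "graded_word is \<gamma> = map (\<lambda>k. Var (\<sigma> k) ((\<gamma> \<circ> \<sigma>) k) False) [1..<Suc n]"
    unfolding graded_word_def
    by (rule nth_equalityI) (simp_all add: len \<sigma>_def nth_append del: upt_Suc)
  moreover have "\<gamma> \<circ> \<sigma> \<in> {1..n} \<rightarrow> carrier G"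
    using \<gamma> permutes_in_image[OF \<sigma>] by (auto simp: Pi_iff simp del: atLeastAtMost_iff)
  ultimately show ?thesis
    unfolding multilinear_words_def using \<sigma> by (auto intro!: exI[of _ \<sigma>] exI[of _ "\<gamma> \<circ> \<sigma>"] exI[of _ "\<lambda>_. False"])
qed

context graded_UT
begin

text \<open>A finite set containing the degrees of all nonzero components of all units, so that
  summing over degrees remains finite when \<open>G\<close> is infinite.\<close>

definition unit_support :: "'g set" where
  "unit_support = (\<Union>t\<in>unit_indices m. supp (component (unit_mat m t)))"

lemma unit_support: "finite unit_support" "unit_support \<subseteq> carrier G"
  using finite_supp_component UT_unit_mat by (auto simp: unit_support_def supp_def)

text \<open>Summation over all degree assignments distributes over the factors, and each factor
  becomes the sum of the components of its unit, that is, the unit itself. What remains is an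
  ordinary product of matrix units.\<close>

lemma sum_graded_words:
  assumes "distinct is" "\<And>i. i \<in> set is \<Longrightarrow> \<tau> i \<in> unit_indices m" and rc: "r < m" "c < m"
  shows "(\<Sum>\<gamma>\<in>set is \<rightarrow>\<^sub>E unit_support. word_val (unit_assignment \<tau>) (graded_word is \<gamma>) $$ (r, c))
    = (if unit_path r (map \<tau> is) c then 1 else 0)"
  using assms(1,2) rc(1)
proof (induction "is" arbitrary: r)
  case Nil
  then show ?case using rc by (simp add: graded_word_def word_val_Nil)
next
  case (Cons i "is")
  let ?\<phi> = "unit_assignment \<tau>" and ?S = unit_support
  let ?P = "set is \<rightarrow>\<^sub>E ?S"
  let ?f = "\<lambda>\<gamma>. word_val ?\<phi> (graded_word (i # is) \<gamma>) $$ (r, c)"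
  let ?w = "\<lambda>\<gamma> k. word_val ?\<phi> (graded_word is \<gamma>) $$ (k, c)"
  have i: "i \<notin> set is" and \<tau>: "\<tau> i \<in> unit_indices m" using Cons.prems by auto
  have word: "?f (\<gamma>(i := g)) = (\<Sum>k<m. ?\<phi> i g $$ (r, k) * ?w \<gamma> k)"
    if g: "g \<in> ?S" and \<gamma>: "\<gamma> \<in> ?P" for g \<gamma>
  proof -
    have "graded_word (i # is) (\<gamma>(i := g)) = Var i g False # graded_word is \<gamma>"
      using i by (auto simp: graded_word_def)
    then have eq: "word_val ?\<phi> (graded_word (i # is) (\<gamma>(i := g))) = ?\<phi> i g * word_val ?\<phi> (graded_word is \<gamma>)"
      by (simp add: word_val_Cons)
    have "?\<phi> i g \<in> carrier_mat m m"
      using g unit_support unfolding unit_assignment_def by (intro UT_dim component_U UT_unit_mat) auto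
    moreover have "word_val ?\<phi> (graded_word is \<gamma>) \<in> carrier_mat m m"
      using \<gamma> unit_support by (intro UT_dim word_val_U admissible_unit_assignment)
        (auto simp: graded_word_def indets_degree)
    ultimately show ?thesis unfolding eq using Cons.prems(3) rc(2) by (rule index_mult_sum)
  qed
  have comp: "(\<Sum>g\<in>?S. ?\<phi> i g $$ (r, k)) = (if (r, k) = \<tau> i then 1 else 0)" if k: "k < m" for k
  proof -
    have "unit_mat m (\<tau> i) $$ (r, k) = (\<Sum>g\<in>?S. ?\<phi> i g $$ (r, k))"
      unfolding unit_assignment_def using unit_support \<tau> Cons.prems(3) k
      by (intro sum_components_superset UT_unit_mat) (auto simp: unit_support_def)
    then show ?thesis using \<tau> Cons.prems(3) k by (auto simp: unit_indices_def)
  qed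
  have "(\<Sum>\<gamma>\<in>set (i # is) \<rightarrow>\<^sub>E ?S. ?f \<gamma>) = (\<Sum>(g, \<gamma>)\<in>?S \<times> ?P. ?f (\<gamma>(i := g)))"
    unfolding list.set PiE_insert_eq
    by (subst sum.reindex[OF inj_combinator[OF i]]) (simp add: case_prod_unfold)
  also have "\<dots> = (\<Sum>(g, \<gamma>)\<in>?S \<times> ?P. \<Sum>k<m. ?\<phi> i g $$ (r, k) * ?w \<gamma> k)"
    using word by (intro sum.cong refl) auto
  also have "\<dots> = (\<Sum>k<m. \<Sum>(g, \<gamma>)\<in>?S \<times> ?P. ?\<phi> i g $$ (r, k) * ?w \<gamma> k)"
    unfolding case_prod_unfold by (rule sum.swap)
  also have "\<dots> = (\<Sum>k<m. (\<Sum>g\<in>?S. ?\<phi> i g $$ (r, k)) * (\<Sum>\<gamma>\<in>?P. ?w \<gamma> k))"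
    by (simp add: sum_product sum.cartesian_product)
  also have "\<dots> = (\<Sum>k<m. (if (r, k) = \<tau> i then 1 else 0) * (if unit_path k (map \<tau> is) c then 1 else 0))"
    using Cons.prems by (intro sum.cong refl arg_cong2[where f = times] comp Cons.IH) auto
  also have "\<dots> = (\<Sum>k<m. if k = snd (\<tau> i) then if unit_path r (map \<tau> (i # is)) c then 1 else 0 else 0)"
    by (intro sum.cong refl) (cases "\<tau> i", auto)
  also have "\<dots> = (if unit_path r (map \<tau> (i # is)) c then 1 else 0)"
    using \<tau> by (subst sum.delta) (auto simp: unit_indices_def)
  finally show ?case .
qed

definition word_poly :: "nat list \<Rightarrow> ('g, 'f) star_poly" where
  "word_poly is = (\<Sum>\<gamma>\<in>set is \<rightarrow>\<^sub>E unit_support. Poly_Mapping.single (graded_word is \<gamma>) 1)"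

lemma word_poly_multilinear:
  assumes "distinct is" "set is = {1..n}"
  shows "word_poly is \<in> multilinear_polys G n"
  unfolding word_poly_def multilinear_polys_def assms(2) using unit_support(2)
  by (intro star_poly.span_sum star_poly.span_base imageI graded_word_multilinear assms) auto

lemma ev_word_poly:
  assumes "distinct is" "\<And>i. i \<in> set is \<Longrightarrow> \<tau> i \<in> unit_indices m" "r < m" "c < m"
  shows "ev (unit_assignment \<tau>) (r, c) (word_poly is) = (if unit_path r (map \<tau> is) c then 1 else 0)"
proof -
  interpret ev: Vector_Spaces.linear poly_scale "(*)" "ev (unit_assignment \<tau>) (r, c)" by (rule linear_ev)
  show ?thesis using sum_graded_words[OF assms] by (simp add: word_poly_def ev.sum ev_single)
qed

section \<open>Bounds for the codimensions\<close>

definition unit_functionals :: "nat \<Rightarrow> (('g, 'f) star_poly \<Rightarrow> 'f) set" where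
  "unit_functionals n = (\<lambda>(\<tau>, rc). ev (unit_assignment \<tau>) rc) ` (unit_tuples n \<times> ({..<m} \<times> {..<m}))"

lemma finite_unit_tuples: "finite (unit_tuples n)"
proof (rule finite_subset)
  show "unit_tuples n \<subseteq> {1..n} \<rightarrow>\<^sub>E unit_indices m" by (simp add: unit_tuples_def)
qed (simp add: finite_PiE)

lemma finite_unit_functionals: "finite (unit_functionals n)"
  and card_unit_functionals: "card (unit_functionals n) \<le> m\<^sup>2 * card (unit_tuples n)"
proof -
  have fin: "finite (unit_tuples n \<times> ({..<m} \<times> {..<m}))" using finite_unit_tuples by simp
  then show "finite (unit_functionals n)" unfolding unit_functionals_def by simp
  have "card (unit_functionals n) \<le> card (unit_tuples n \<times> ({..<m} \<times> {..<m}))"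
    unfolding unit_functionals_def by (rule card_image_le[OF fin])
  then show "card (unit_functionals n) \<le> m\<^sup>2 * card (unit_tuples n)"
    by (simp add: card_cartesian_product power2_eq_square mult.commute)
qed

lemma star_codimension_bounds:
  shows "star_codimension G (UT m) \<A> star n \<le> m\<^sup>2 * card (unit_tuples n)"
    and "n = N + (m - 1) \<Longrightarrow> m ^ N \<le> star_codimension G (UT m) \<A> star n"
proof -
  let ?V = "multilinear_polys G n :: ('g, 'f) star_poly set"
  let ?W = "?V \<inter> star_identities G (UT m) \<A> star"
  note free = subsetD[OF multilinear_polys_free]
  have V: "star_poly.subspace ?V" unfolding multilinear_polys_def by (rule star_poly.subspace_span)
  have W_iff: "p \<in> ?W \<longleftrightarrow> p \<in> ?V \<and> (\<forall>\<phi>. admissible \<phi> \<longrightarrow> (\<forall>r<m. \<forall>c<m. ev \<phi> (r, c) p = 0))" for p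
    using star_identities_iff[OF free, of p n] by blast
  have lin: "ev \<phi> rc (p + q) = ev \<phi> rc p + ev \<phi> rc q" "ev \<phi> rc (poly_scale a p) = a * ev \<phi> rc p"
    "ev \<phi> rc 0 = 0" for \<phi> rc p q a
  proof -
    interpret ev: Vector_Spaces.linear poly_scale "(*)" "ev \<phi> rc" by (rule linear_ev)
    show "ev \<phi> rc (p + q) = ev \<phi> rc p + ev \<phi> rc q" "ev \<phi> rc (poly_scale a p) = a * ev \<phi> rc p"
      "ev \<phi> rc 0 = 0" by (simp_all add: ev.add ev.scale)
  qed
  have W_eq: "?W = {p. p \<in> ?V \<and> (\<forall>\<phi>. admissible \<phi> \<longrightarrow> (\<forall>r<m. \<forall>c<m. ev \<phi> (r, c) p = 0))}"
    using W_iff by blast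
  have W: "star_poly.subspace ?W"
    unfolding W_eq star_poly.subspace_def using V[unfolded star_poly.subspace_def]
    by (simp add: lin)
  have linear: "Vector_Spaces.linear poly_scale (*) L" if "L \<in> unit_functionals n" for L
    using that linear_ev by (auto simp: unit_functionals_def)
  have vanish: "L p = 0" if "L \<in> unit_functionals n" "p \<in> ?W" for L p
    using that admissible_unit_assignment W_iff by (auto simp: unit_functionals_def)
  have separate: "p \<in> ?W" if "p \<in> ?V" "\<And>L. L \<in> unit_functionals n \<Longrightarrow> L p = 0" for p
  proof -
    have "ev (unit_assignment \<tau>) (r, c) p = 0" if "\<tau> \<in> unit_tuples n" "r < m" "c < m" for \<tau> r c
      using \<open>\<And>L. L \<in> unit_functionals n \<Longrightarrow> L p = 0\<close> that by (force simp: unit_functionals_def)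
    then show ?thesis unfolding W_iff using that(1) ev_zero_of_unit_tuples by blast
  qed
  note bounds = star_poly.quotient_dim_bounds[where \<L> = "unit_functionals n",
      OF V W _ _ finite_unit_functionals]
  have upper: "quotient_dim poly_scale ?V ?W \<le> card (unit_functionals n)"
    by (rule bounds(1)) (fact linear vanish separate)+
  show "star_codimension G (UT m) \<A> star n \<le> m\<^sup>2 * card (unit_tuples n)"
    unfolding star_codimension_def using upper card_unit_functionals[of n] by (rule order_trans)
  assume n: "n = N + (m - 1)"
  define I where "I = {1..N} \<rightarrow>\<^sub>E {..<m}"
  define p where "p f = word_poly (block_list N f (m - 1))" for f
  define \<tau> where "\<tau> h = restrict (block_unit N h) {1..n}" for h
  \<comment> \<open>The separators lead from node 0 to node \<open>m - 1\<close>, so the entry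
    \<open>(0, m - 1)\<close> is the one that detects a complete path. It makes \<open>l\<close> and
    \<open>p\<close> dual to each other, both indexed by the maps from \<open>{1..N}\<close> to
    \<open>{..<m}\<close>.\<close>
  define l where "l h = ev (unit_assignment (\<tau> h)) (0, m - 1)" for h
  have set: "set (block_list N f (m - 1)) = {1..n}" if "f \<in> I" for f
  proof -
    have "{i\<in>{1..N}. f i \<le> m - 1} = {1..N}" using PiE_mem[OF that[unfolded I_def]] m_pos by fastforce
    moreover have "{1..N} \<union> {N + 1..N + (m - 1)} = {1..N + (m - 1)}" by auto
    ultimately show ?thesis by (simp only: set_block_list n)
  qed
  have \<tau>: "\<tau> h \<in> {1..n} \<rightarrow>\<^sub>E unit_indices m" if "h \<in> I" for h
  proof -
    have "block_unit N h i \<in> unit_indices m" if i: "i \<in> {1..n}" for i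
    proof (cases "i \<le> N")
      case True
      then have "h i < m" using PiE_mem[OF \<open>h \<in> I\<close>[unfolded I_def], of i] i by simp
      then show ?thesis using True by (simp add: block_unit_def unit_indices_def)
    next
      case False
      moreover have "i - Suc N \<le> i - N" "i - N < m" using False i n m_pos by auto
      ultimately show ?thesis by (simp add: block_unit_def unit_indices_def)
    qed
    then show ?thesis by (simp add: \<tau>_def)
  qed
  have "card I \<le> quotient_dim poly_scale ?V ?W"
  proof (rule bounds(2)[where I = I and p = p and l = l])
    show "\<And>L. L \<in> unit_functionals n \<Longrightarrow> Vector_Spaces.linear poly_scale (*) L"
      "\<And>L p. \<lbrakk>L \<in> unit_functionals n; p \<in> ?W\<rbrakk> \<Longrightarrow> L p = 0"
      "\<And>p. \<lbrakk>p \<in> ?V; \<And>L. L \<in> unit_functionals n \<Longrightarrow> L p = 0\<rbrakk> \<Longrightarrow> p \<in> ?W"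
      by (fact linear vanish separate)+
    show "finite I" by (auto simp: I_def intro!: finite_PiE)
    show "p f \<in> ?V" if "f \<in> I" for f
      unfolding p_def by (rule word_poly_multilinear[OF distinct_block_list set[OF that]])
    show "l h \<in> unit_functionals n" if "h \<in> I" for h
    proof -
      \<comment> \<open>Only the \<open>m - 1\<close> separators carry off-diagonal units, just
        within the bound imposed by \<open>unit_tuples\<close>.\<close>
      have "{i\<in>{1..n}. fst (\<tau> h i) < snd (\<tau> h i)} \<subseteq> {N + 1..n}"
        by (auto simp: \<tau>_def block_unit_def split: if_splits)
      from card_mono[OF _ this] have "card {i\<in>{1..n}. fst (\<tau> h i) < snd (\<tau> h i)} < m"
        using m_pos n by simp
      then have "\<tau> h \<in> unit_tuples n" using \<tau>[OF that] by (simp add: unit_tuples_def)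
      then have "(\<tau> h, (0, m - 1)) \<in> unit_tuples n \<times> ({..<m} \<times> {..<m})" using m_pos by simp
      from imageI[OF this, of "\<lambda>(\<tau>, rc). ev (unit_assignment \<tau>) rc"]
      show ?thesis unfolding l_def unit_functionals_def by simp
    qed
    fix h f assume h: "h \<in> I" and f: "f \<in> I"
    have "map (\<tau> h) (block_list N f (m - 1)) = map (block_unit N h) (block_list N f (m - 1))"
      using set[OF f] by (simp add: \<tau>_def)
    then have path: "unit_path 0 (map (\<tau> h) (block_list N f (m - 1))) (m - 1) \<longleftrightarrow>
        (\<forall>i\<in>{1..N}. f i \<le> m - 1 \<longrightarrow> h i = f i)"
      using unit_path_block_list[of N h f "m - 1" "[]" "m - 1"]
      by (simp only: append_Nil2 unit_path.simps simp_thms)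
    have "\<dots> \<longleftrightarrow> h = f"
    proof
      assume *: "\<forall>i\<in>{1..N}. f i \<le> m - 1 \<longrightarrow> h i = f i"
      show "h = f"
      proof (rule PiE_ext[OF h[unfolded I_def] f[unfolded I_def]])
        fix i assume i: "i \<in> {1..N}"
        then have "f i < m" using f by (auto simp: I_def)
        then show "h i = f i" using * i by simp
      qed
    qed simp
    with path have path': "unit_path 0 (map (\<tau> h) (block_list N f (m - 1))) (m - 1) \<longleftrightarrow> h = f"
      by (rule trans)
    have "\<tau> h i \<in> unit_indices m" if "i \<in> set (block_list N f (m - 1))" for i
      using PiE_mem[OF \<tau>[OF h]] that unfolding set[OF f] .
    then show "l h (p f) = (if h = f then 1 else 0)"
      unfolding l_def p_def path'[symmetric] using m_pos
      by (intro ev_word_poly distinct_block_list) simp_all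
  qed
  moreover have "card I = m ^ N" by (simp add: I_def card_funcsetE)
  ultimately show "m ^ N \<le> star_codimension G (UT m) \<A> star n" by (simp add: star_codimension_def)
qed

section \<open>Asymptotics\<close>

lemma card_unit_tuples_le:
  assumes n: "n > 0"
  shows "real (card (unit_tuples n)) \<le> real n ^ m * (real m + (real m)\<^sup>2 / real n) ^ n"
proof -
  \<comment> \<open>Weighting off-diagonal units by \<open>1 / n\<close> turns the count into an \<open>n\<close>-th power.\<close>
  define wt :: "nat \<times> nat \<Rightarrow> real" where "wt t = (if fst t < snd t then 1 / real n else 1)" for t
  let ?T = "unit_indices m"
  have wt_pos: "wt t \<ge> 0" for t by (simp add: wt_def)
  have "card {t\<in>?T. fst t < snd t} \<le> card ({..<m} \<times> {..<m})"
    by (intro card_mono) (auto simp: unit_indices_def)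
  then have off: "real (card {t\<in>?T. fst t < snd t}) \<le> (real m)\<^sup>2"
    by (simp add: power2_eq_square flip: of_nat_mult)
  have "{t\<in>?T. \<not> fst t < snd t} = (\<lambda>j. (j, j)) ` {..<m}" by (auto simp: unit_indices_def)
  then have "card {t\<in>?T. \<not> fst t < snd t} = m" by (simp add: card_image inj_on_def)
  then have "(\<Sum>t\<in>?T. wt t) = real (card {t\<in>?T. fst t < snd t}) / real n + real m"
    by (simp add: wt_def sum.If_cases Int_def Collect_neg_eq[symmetric])
  also have "\<dots> \<le> real m + (real m)\<^sup>2 / real n"
    using off n by (simp add: divide_right_mono)
  finally have sum: "(\<Sum>t\<in>?T. wt t) \<le> real m + (real m)\<^sup>2 / real n" .
  \<comment> \<open>A tuple in \<open>unit_tuples\<close> has fewer than \<open>m\<close> factors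
    \<open>1 / n\<close> in its weight. Dropping that restriction on the tuples afterwards only
    increases the total weight, which then factors as an \<open>n\<close>-th power.\<close>
  have "(1 / real n) ^ m \<le> (\<Prod>i\<in>{1..n}. wt (\<tau> i))" if "\<tau> \<in> unit_tuples n" for \<tau>
  proof -
    have "(\<Prod>i\<in>{1..n}. wt (\<tau> i)) = (1 / real n) ^ card {i\<in>{1..n}. fst (\<tau> i) < snd (\<tau> i)}"
      by (simp add: wt_def prod.If_cases Int_def)
    moreover have "card {i\<in>{1..n}. fst (\<tau> i) < snd (\<tau> i)} \<le> m"
      using that by (simp add: unit_tuples_def)
    ultimately show ?thesis using n by (simp add: power_decreasing)
  qed
  then have "real (card (unit_tuples n)) * (1 / real n) ^ m \<le> (\<Sum>\<tau>\<in>unit_tuples n. \<Prod>i\<in>{1..n}. wt (\<tau> i))"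
    using sum_mono[of "unit_tuples n" "\<lambda>_. (1 / real n) ^ m" "\<lambda>\<tau>. \<Prod>i\<in>{1..n}. wt (\<tau> i)"] by simp
  also have "\<dots> \<le> (\<Sum>\<tau>\<in>{1..n} \<rightarrow>\<^sub>E ?T. \<Prod>i\<in>{1..n}. wt (\<tau> i))"
    by (intro sum_mono2 prod_nonneg finite_PiE) (auto simp: unit_tuples_def wt_pos)
  also have "\<dots> = (\<Sum>t\<in>?T. wt t) ^ n"
    by (subst prod_sum_PiE[symmetric]) auto
  also have "\<dots> \<le> (real m + (real m)\<^sup>2 / real n) ^ n"
    by (intro power_mono sum sum_nonneg wt_pos)
  finally show ?thesis using n by (simp add: field_simps)
qed

lemma root_star_codimension_tendsto:
  "(\<lambda>n. root n (real (star_codimension G (UT m) \<A> star n))) \<longlonglongrightarrow> real m"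
proof (rule tendsto_sandwich)
  let ?c = "star_codimension G (UT m) \<A> star"
  let ?L = "\<lambda>n. real m / root n (real m ^ (m - 1))"
  let ?R = "\<lambda>n. root n ((real m)\<^sup>2) * root n (real n) ^ m * (real m + (real m)\<^sup>2 / real n)"
  show "\<forall>\<^sub>F n in sequentially. ?L n \<le> root n (real (?c n))"
  \<comment> \<open>From \<open>m\<close> on, \<open>n - (m - 1)\<close> is a genuine difference and
    can serve as \<open>N\<close>; moreover \<open>n\<close> is positive, as the laws for
    \<open>root n\<close> require.\<close>
  proof (rule eventually_sequentiallyI[of m])
    fix n assume "m \<le> n"
    then have n: "n = (n - (m - 1)) + (m - 1)" "n > 0" using m_pos by auto
    have "real m ^ (n - (m - 1)) \<le> real (?c n)"
      using star_codimension_bounds(2)[OF n(1)] by (metis of_nat_le_iff of_nat_power)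
    moreover have "real m ^ (n - (m - 1)) = real m ^ n / real m ^ (m - 1)"
      using n m_pos by (subst power_diff) auto
    ultimately have "real m ^ n / real m ^ (m - 1) \<le> real (?c n)" by (simp only:)
    then have "root n (real m ^ n / real m ^ (m - 1)) \<le> root n (real (?c n))"
      by (rule real_root_le_mono[OF n(2)])
    then show "?L n \<le> root n (real (?c n))"
      using n(2) by (simp add: real_root_divide real_root_power_cancel)
  qed
  show "\<forall>\<^sub>F n in sequentially. root n (real (?c n)) \<le> ?R n"
  proof (rule eventually_sequentiallyI[of 1])
    fix n :: nat assume "1 \<le> n"
    then have n: "n > 0" by simp
    have "real (?c n) \<le> (real m)\<^sup>2 * real (card (unit_tuples n))"
      using star_codimension_bounds(1)[of n] by (metis of_nat_le_iff of_nat_mult of_nat_power)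
    also have "\<dots> \<le> (real m)\<^sup>2 * (real n ^ m * (real m + (real m)\<^sup>2 / real n) ^ n)"
      by (intro mult_left_mono card_unit_tuples_le n) simp
    finally have "root n (real (?c n))
        \<le> root n ((real m)\<^sup>2 * (real n ^ m * (real m + (real m)\<^sup>2 / real n) ^ n))"
      using n by simp
    also have "\<dots> = ?R n"
      using n by (simp add: real_root_mult real_root_power real_root_power_cancel)
    finally show "root n (real (?c n)) \<le> ?R n" .
  qed
  have "?L \<longlonglongrightarrow> real m / 1" using m_pos by (intro tendsto_intros LIMSEQ_root_const) auto
  then show "?L \<longlonglongrightarrow> real m" by simp
  have "?R \<longlonglongrightarrow> 1 * 1 ^ m * (real m + 0)"
    using m_pos by (intro tendsto_intros LIMSEQ_root_const LIMSEQ_root lim_const_over_n) auto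
  then show "?R \<longlonglongrightarrow> real m" by simp
qed

end

theorem corollary2p27:
  fixes G :: "('g, 'q) monoid_scheme"
    and m :: nat
    and \<A> :: "'g \<Rightarrow> 'f::field_char_0 mat set"
    and star :: "'f mat \<Rightarrow> 'f mat"
  assumes "comm_group G"
    and "m > 0"
    and "grading G (UT m) \<A>"
    and "graded_involution G (UT m) \<A> star"
  shows "star_exponent_exists G (UT m) \<A> star \<and> star_exponent G (UT m) \<A> star = real m"
proof -
  interpret graded_UT G m \<A> star by (rule graded_UT.intro) fact+
  show ?thesis
    using root_star_codimension_tendsto
    unfolding star_exponent_exists_def star_exponent_def convergent_def by (blast intro: limI)
qed

end
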